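(* Let $S=\mathbb{K}[x_1,\dots,x_n]$ be a polynomial ring over a field $\mathbb{K}$ and let $I\subseteq S$ be a monomial ideal which contains no variable (i.e. $x_i\notin I$ for all $i$). Assume that there exists an integer $s\geq 1$ such that $I^s$ is componentwise linear. Then for every pair of monomials $u,v\in G(I)$ with $\gcd(u,v)=1$, there exists a monomial $w\in G(I)$ such that $w\neq u$, $w\neq v$ and $\operatorname{supp}(w)\subseteq \operatorname{supp}(u)\cup\operatorname{supp}(v)$.
   Context: $G(I)$ denotes the set of minimal monomial generators of a monomial ideal $I$. For a monomial $u$, $\operatorname{supp}(u)$ is the set of variables dividing $u$. A monomial ideal $J$ has a linear resolution if for some integer $d$, the graded Betti numbers satisfy $\beta_{i,i+t}(J)=0$ for all $i$ and all $t\neq d$. For a monomial ideal $I$ and integer $j$, $I_{\langle j\rangle}$ denotes the ideal generated by all monomials of degree $j$ belonging to $I$. A monomial ideal $I$ is componentwise linear if $I_{\langle j\rangle}$ has a linear resolution for every $j$. *)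

theory Defs
  imports Main "HOL-Library.Poly_Mapping"
begin

(* Polynomial ring S = K[x_i : i :: 'n] over a field K ('a::field), with a finite
   (hence nonempty, so n >= 1) type 'n of variables.  A polynomial is a finitely
   supported map from exponent vectors (monomials) to coefficients; multiplication
   is the convolution product of HOL-Library.Poly_Mapping. *)
type_synonym ('n, 'a) mpoly = "('n \<Rightarrow>\<^sub>0 nat) \<Rightarrow>\<^sub>0 'a"

definition monom :: "('n \<Rightarrow>\<^sub>0 nat) \<Rightarrow> ('n, 'a::field) mpoly" where
  "monom m = Poly_Mapping.single m 1"

definition mdeg :: "('n \<Rightarrow>\<^sub>0 nat) \<Rightarrow> nat" where
  "mdeg m = (\<Sum>i\<in>Poly_Mapping.keys m. Poly_Mapping.lookup m i)"

definition mdvd :: "('n \<Rightarrow>\<^sub>0 nat) \<Rightarrow> ('n \<Rightarrow>\<^sub>0 nat) \<Rightarrow> bool" where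
  "mdvd u v \<longleftrightarrow> (\<forall>i. Poly_Mapping.lookup u i \<le> Poly_Mapping.lookup v i)"

definition mcoprime :: "('n \<Rightarrow>\<^sub>0 nat) \<Rightarrow> ('n \<Rightarrow>\<^sub>0 nat) \<Rightarrow> bool" where
  "mcoprime u v \<longleftrightarrow> (\<forall>i. min (Poly_Mapping.lookup u i) (Poly_Mapping.lookup v i) = 0)"

definition msupp :: "('n \<Rightarrow>\<^sub>0 nat) \<Rightarrow> 'n set" where
  "msupp u = {i. Poly_Mapping.lookup u i \<noteq> 0}"

definition var :: "'n \<Rightarrow> ('n \<Rightarrow>\<^sub>0 nat)" where
  "var i = Poly_Mapping.single i 1"

definition is_ideal :: "('n, 'a::field) mpoly set \<Rightarrow> bool" where
  "is_ideal I \<longleftrightarrow> 0 \<in> I \<and> (\<forall>a\<in>I. \<forall>b\<in>I. a + b \<in> I) \<and> (\<forall>a\<in>I. \<forall>r. r * a \<in> I)"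

definition ideal_gen :: "('n, 'a::field) mpoly set \<Rightarrow> ('n, 'a) mpoly set" where
  "ideal_gen X = \<Inter>{J. is_ideal J \<and> X \<subseteq> J}"

definition monomial_ideal :: "('n, 'a::field) mpoly set \<Rightarrow> bool" where
  "monomial_ideal I \<longleftrightarrow> is_ideal I \<and> (\<forall>f\<in>I. \<forall>m\<in>Poly_Mapping.keys f. monom m \<in> I)"

definition mingens :: "('n, 'a::field) mpoly set \<Rightarrow> ('n \<Rightarrow>\<^sub>0 nat) set" where
  "mingens I = {m. monom m \<in> I \<and> (\<forall>m'. monom m' \<in> I \<and> mdvd m' m \<longrightarrow> m' = m)}"

fun ideal_pow :: "('n, 'a::field) mpoly set \<Rightarrow> nat \<Rightarrow> ('n, 'a) mpoly set" where
  "ideal_pow I 0 = UNIV"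
| "ideal_pow I (Suc k) = ideal_gen {a * b | a b. a \<in> I \<and> b \<in> ideal_pow I k}"

definition deg_comp :: "('n, 'a::field) mpoly set \<Rightarrow> nat \<Rightarrow> ('n, 'a) mpoly set" where
  "deg_comp I j = ideal_gen {monom m | m. monom m \<in> I \<and> mdeg m = j}"

(* f is homogeneous of degree e (the zero polynomial is homogeneous of every degree) *)
definition homog :: "int \<Rightarrow> ('n, 'a::zero) mpoly \<Rightarrow> bool" where
  "homog e f \<longleftrightarrow> (\<forall>m\<in>Poly_Mapping.keys f. int (mdeg m) = e)"

(* Graded free resolutions of an ideal J:
     ... -> F_2 --d_2--> F_1 --d_1--> F_0 --d_0--> J -> 0,
   F_i = (+)_{l < r i} S(-a i l), the basis element e_l of F_i having degree a i l.
   d i is given by a matrix: d i k l is the k-th coordinate of the image of e_l.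
   The target of d 0 is S (one coordinate, degree 0); the target of d (Suc i) is F_i. *)
definition trank :: "(nat \<Rightarrow> nat) \<Rightarrow> nat \<Rightarrow> nat" where
  "trank r i = (case i of 0 \<Rightarrow> 1 | Suc j \<Rightarrow> r j)"

definition tdeg :: "(nat \<Rightarrow> nat \<Rightarrow> int) \<Rightarrow> nat \<Rightarrow> nat \<Rightarrow> int" where
  "tdeg a i k = (case i of 0 \<Rightarrow> 0 | Suc j \<Rightarrow> a j k)"

definition fvecs :: "(nat \<Rightarrow> nat) \<Rightarrow> nat \<Rightarrow> (nat \<Rightarrow> ('n, 'a::field) mpoly) set" where
  "fvecs r i = {x. \<forall>l. r i \<le> l \<longrightarrow> x l = 0}"

definition fmap :: "(nat \<Rightarrow> nat) \<Rightarrow> (nat \<Rightarrow> nat \<Rightarrow> nat \<Rightarrow> ('n, 'a::field) mpoly) \<Rightarrow> nat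
                    \<Rightarrow> (nat \<Rightarrow> ('n, 'a) mpoly) \<Rightarrow> (nat \<Rightarrow> ('n, 'a) mpoly)" where
  "fmap r d i x = (\<lambda>k. if k < trank r i then (\<Sum>l<r i. d i k l * x l) else 0)"

definition graded_free_res ::
  "('n, 'a::field) mpoly set \<Rightarrow> (nat \<Rightarrow> nat) \<Rightarrow> (nat \<Rightarrow> nat \<Rightarrow> int)
   \<Rightarrow> (nat \<Rightarrow> nat \<Rightarrow> nat \<Rightarrow> ('n, 'a) mpoly) \<Rightarrow> bool" where
  "graded_free_res J r a d \<longleftrightarrow>
     (\<forall>i k l. homog (a i l - tdeg a i k) (d i k l)) \<and>
     {fmap r d 0 x 0 | x. x \<in> fvecs r 0} = J \<and>
     (\<forall>i. {x \<in> fvecs r i. fmap r d i x = (\<lambda>_. 0)} = fmap r d (Suc i) ` fvecs r (Suc i))"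

(* minimal: all differentials d_i (i >= 1) map into m F_{i-1}, m = (x_1,...,x_n) *)
definition minimal_graded_free_res ::
  "('n, 'a::field) mpoly set \<Rightarrow> (nat \<Rightarrow> nat) \<Rightarrow> (nat \<Rightarrow> nat \<Rightarrow> int)
   \<Rightarrow> (nat \<Rightarrow> nat \<Rightarrow> nat \<Rightarrow> ('n, 'a) mpoly) \<Rightarrow> bool" where
  "minimal_graded_free_res J r a d \<longleftrightarrow> graded_free_res J r a d \<and>
     (\<forall>i k l. Poly_Mapping.lookup (d (Suc i) k l) 0 = 0)"

(* graded Betti numbers beta_{i,j}(J): number of basis elements of degree j in F_i
   of a minimal graded free resolution of J (well defined up to isomorphism) *)
definition betti :: "('n, 'a::field) mpoly set \<Rightarrow> nat \<Rightarrow> int \<Rightarrow> nat" where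
  "betti J i j = (let (r, a, d) = (SOME (r, a, d). minimal_graded_free_res J r a d)
                  in card {l. l < r i \<and> a i l = j})"

definition linear_resolution :: "('n, 'a::field) mpoly set \<Rightarrow> bool" where
  "linear_resolution J \<longleftrightarrow> (\<exists>d::int. \<forall>i t. t \<noteq> d \<longrightarrow> betti J i (int i + t) = 0)"

definition componentwise_linear :: "('n, 'a::field) mpoly set \<Rightarrow> bool" where
  "componentwise_linear I \<longleftrightarrow> (\<forall>j. linear_resolution (deg_comp I j))"

end

theory Submission
  imports Complex_Main Defs
begin

text \<open>Suppose that \<open>u\<close> and \<open>v\<close> are coprime generators with \<open>deg u \<le> deg v\<close> and that no other
  generator is supported in \<open>W = supp u \<union> supp v\<close>.  Then every monomial of \<open>I\<^sup>s\<close> of degree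
  \<open>j = s \<cdot> deg v\<close> supported in \<open>W\<close> is \<open>v\<^sup>s\<close> or divisible by \<open>u\<close>.  As \<open>deg u \<ge> 2\<close> and \<open>u\<close> is
  coprime to \<open>v\<close>, no monomial of the latter kind arises from \<open>v\<^sup>s\<close> by exchanging a single
  variable.  Such an isolated monomial cannot occur when the degree \<open>j\<close> component of \<open>I\<^sup>s\<close>
  has linear syzygies.  Since Betti numbers are read off a chosen minimal resolution, one also
  has to know that minimal resolutions exist; for a monomial ideal one is built multidegree by
  multidegree, where all conditions become linear algebra over the field.\<close>

abbreviation "lookup \<equiv> Poly_Mapping.lookup"

abbreviation "keys \<equiv> Poly_Mapping.keys"

subsection \<open>Monomials\<close>

lemma mdvd_refl [simp]: "mdvd m m"
  by (simp add: mdvd_def)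

lemma mdvd_trans: "mdvd a b \<Longrightarrow> mdvd b c \<Longrightarrow> mdvd a c"
  unfolding mdvd_def by (meson le_trans)

lemma mdvd_zero [simp]: "mdvd 0 m"
  by (simp add: mdvd_def)

lemma mdvd_add [simp]: "mdvd a (a + b)" "mdvd a (b + a)"
  by (simp_all add: mdvd_def lookup_add)

lemma mdvd_add_diff: "mdvd a b \<Longrightarrow> a + (b - a) = b"
  by (intro poly_mapping_eqI) (simp add: mdvd_def lookup_add lookup_minus)

lemma mdvd_diff_add: "mdvd a b \<Longrightarrow> (b - a) + a = b"
  by (metis mdvd_add_diff add.commute)

lemma mdeg_UNIV:
  fixes m :: "'n::finite \<Rightarrow>\<^sub>0 nat"
  shows "mdeg m = (\<Sum>i\<in>UNIV. lookup m i)"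
  unfolding mdeg_def by (rule sum.mono_neutral_left) (auto simp: in_keys_iff)

lemma mdeg_add [simp]: "mdeg (a + b) = mdeg a + mdeg (b :: 'n::finite \<Rightarrow>\<^sub>0 nat)"
  by (simp add: mdeg_UNIV lookup_add sum.distrib)

lemma mdeg_zero [simp]: "mdeg 0 = 0"
  by (simp add: mdeg_def)

lemma mdeg_eq_0_iff [simp]: "mdeg (m :: 'n::finite \<Rightarrow>\<^sub>0 nat) = 0 \<longleftrightarrow> m = 0"
proof
  assume "mdeg m = 0"
  then show "m = 0"
    by (intro poly_mapping_eqI) (simp add: mdeg_UNIV)
qed simp

lemma mdvd_mdeg_eq:
  fixes a b :: "'n::finite \<Rightarrow>\<^sub>0 nat"
  assumes "mdvd a b" "mdeg b \<le> mdeg a"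
  shows "a = b"
proof -
  have b: "a + (b - a) = b" using assms(1) by (rule mdvd_add_diff)
  then have "mdeg a + mdeg (b - a) = mdeg b" by (metis mdeg_add)
  with assms(2) have "mdeg (b - a) = 0" by linarith
  then have "b - a = 0" by (simp only: mdeg_eq_0_iff)
  with b show ?thesis by simp
qed

lemma mdvd_mdeg_le: "mdvd a b \<Longrightarrow> mdeg a \<le> mdeg (b :: 'n::finite \<Rightarrow>\<^sub>0 nat)"
  by (simp add: mdeg_UNIV mdvd_def sum_mono)

lemma mdeg_eq_1_iff: "mdeg (m :: 'n::finite \<Rightarrow>\<^sub>0 nat) = 1 \<longleftrightarrow> (\<exists>i. m = var i)"
proof
  assume m: "mdeg m = 1"
  then have "m \<noteq> 0" by auto
  then obtain i where "lookup m i \<noteq> 0"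
    by (metis poly_mapping_eqI lookup_zero)
  then have "mdvd (var i) m"
    by (auto simp: mdvd_def var_def lookup_single when_def)
  moreover have "mdeg (var i) = 1" by (simp add: mdeg_def var_def)
  ultimately show "\<exists>i. m = var i" using mdvd_mdeg_eq[of "var i" m] m by auto
next
  assume "\<exists>i. m = var i"
  then show "mdeg m = 1" by (auto simp: mdeg_def var_def)
qed

section \<open>Dickson's lemma\<close>

text \<open>Coordinates are treated one at a time: passing to a further subsequence makes the next
  coordinate nondecreasing and keeps the earlier ones so.\<close>

lemma mdvd_chain_coordinates:
  fixes f :: "nat \<Rightarrow> ('n \<Rightarrow>\<^sub>0 nat)"
  assumes "finite A"
  shows "\<exists>g :: nat \<Rightarrow> nat. strict_mono g \<and>
    (\<forall>k\<in>A. \<forall>i j. i \<le> j \<longrightarrow> lookup (f (g i)) k \<le> lookup (f (g j)) k)"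
  using assms
proof (induction A)
  case empty
  then show ?case by (auto intro!: exI[of _ "\<lambda>i. i"] simp: strict_mono_def)
next
  case (insert a A)
  from insert.IH obtain g :: "nat \<Rightarrow> nat" where
    gA: "strict_mono g \<and>
      (\<forall>k\<in>A. \<forall>i j. i \<le> j \<longrightarrow> lookup (f (g i)) k \<le> lookup (f (g j)) k)" ..
  then have g: "strict_mono g" by simp
  have le: "lookup (f (g i)) k \<le> lookup (f (g j)) k" if "k \<in> A" "i \<le> j" for k i j
    using gA that by simp
  define s where "s i = lookup (f (g i)) a" for i
  have "\<exists>h :: nat \<Rightarrow> nat. strict_mono h \<and> (\<forall>i j. i \<le> j \<longrightarrow> s (h i) \<le> s (h j))"
  proof -
    obtain h where h: "strict_mono h" "monoseq (\<lambda>n. s (h n))"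
      using seq_monosub[of s] by blast
    from h(2) consider "\<forall>m. \<forall>n\<ge>m. s (h m) \<le> s (h n)" | "\<forall>m. \<forall>n\<ge>m. s (h n) \<le> s (h m)"
      unfolding monoseq_def by blast
    then show ?thesis
    proof cases
      case 1
      with h show ?thesis by (intro exI[of _ h]) simp
    next
      case 2
      \<comment> \<open>A nonincreasing sequence of naturals is constant from an index
        \<open>N\<close> of its minimum on, so dropping the first \<open>N\<close> terms leaves a
        nondecreasing one.\<close>
      define N where "N = (ARG_MIN (\<lambda>n. s (h n)) n. True)"
      have min: "s (h N) \<le> s (h n)" for n
        unfolding N_def by (rule arg_min_nat_le) simp
      have eq: "s (h (n + N)) = s (h N)" for n
        using min[of "n + N"] 2[rule_format, of N "n + N"] by simp
      have "strict_mono (\<lambda>n. h (n + N))"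
        using h(1) by (auto simp: strict_mono_def)
      with eq show ?thesis by (intro exI[of _ "\<lambda>n. h (n + N)"]) simp
    qed
  qed
  then obtain h :: "nat \<Rightarrow> nat" where h: "strict_mono h" and s: "\<And>i j. i \<le> j \<Longrightarrow> s (h i) \<le> s (h j)"
    by blast
  have "strict_mono (g \<circ> h)" using g h by (rule strict_mono_o)
  moreover have "lookup (f (g (h i))) k \<le> lookup (f (g (h j))) k"
    if "k \<in> insert a A" "i \<le> j" for k i j
  proof (cases "k = a")
    case True
    with s[OF that(2)] show ?thesis by (simp add: s_def)
  next
    case False
    with that h show ?thesis by (intro le) (auto simp: strict_mono_less_eq)
  qed
  ultimately show ?case by (intro exI[of _ "g \<circ> h"]) (simp add: o_def)
qed

text \<open>\<open>B\<close> is the set of minimal elements of \<open>E\<close>. An infinite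
  \<open>B\<close> would contain an injective sequence, which by the previous lemma has two
  comparable terms, against minimality. Descent on the degree finds a minimal element below any
  given one.\<close>

lemma dickson:
  fixes E :: "('n::finite \<Rightarrow>\<^sub>0 nat) set"
  shows "\<exists>B. finite B \<and> B \<subseteq> E \<and> (\<forall>e\<in>E. \<exists>b\<in>B. mdvd b e)"
proof -
  define B where "B = {b\<in>E. \<forall>e\<in>E. mdvd e b \<longrightarrow> e = b}"
  have "finite B"
  proof (rule ccontr)
    assume "infinite B"
    then obtain f :: "nat \<Rightarrow> ('n \<Rightarrow>\<^sub>0 nat)" where f: "inj f" "\<And>n. f n \<in> B"
      using infinite_countable_subset[of B] by (metis range_subsetD)
    obtain g :: "nat \<Rightarrow> nat" where g: "strict_mono g"
      and le: "\<And>k i j. i \<le> j \<Longrightarrow> lookup (f (g i)) k \<le> lookup (f (g j)) k"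
      using mdvd_chain_coordinates[of UNIV f, OF finite] by auto
    have "mdvd (f (g 0)) (f (g 1))" using le[of 0 1] by (simp add: mdvd_def)
    then have "f (g 0) = f (g 1)" using f(2) unfolding B_def by blast
    with f(1) have "g 0 = g 1" by (simp add: inj_eq)
    with g show False by (metis strict_mono_eq zero_neq_one)
  qed
  moreover have "\<exists>b\<in>B. mdvd b e" if "e \<in> E" for e
    using that
  proof (induction "mdeg e" arbitrary: e rule: less_induct)
    case less
    show ?case
    proof (cases "e \<in> B")
      case False
      then obtain e' where e': "e' \<in> E" "mdvd e' e" "e' \<noteq> e"
        using less.prems unfolding B_def by blast
      then have "mdeg e' < mdeg e" using mdvd_mdeg_eq[of e' e] by (meson not_le)
      from less.hyps[OF this e'(1)] e'(2) show ?thesis by (blast intro: mdvd_trans)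
    qed (auto intro: mdvd_refl)
  qed
  ultimately show ?thesis by (intro exI[of _ B]) (auto simp: B_def)
qed

subsection \<open>Monotone families of subspaces\<close>

text \<open>A multigraded submodule of the free module with basis elements \<open>e\<^sub>l\<close> of
  multidegree \<open>b l\<close> (\<open>l < r\<close>) is encoded by the coefficient vectors of its homogeneous
  components: \<open>y \<in> N \<beta>\<close> stands for the element with coordinates \<open>y l \<cdot> x\<^bsup>\<beta> - b l\<^esup>\<close>.\<close>

definition subspace_family ::
  "nat \<Rightarrow> (('n \<Rightarrow>\<^sub>0 nat) \<Rightarrow> (nat \<Rightarrow> 'a::field) set) \<Rightarrow> bool" where
  "subspace_family r N \<longleftrightarrow>
     (\<forall>\<beta>. (\<lambda>_. 0) \<in> N \<beta>) \<and>
     (\<forall>\<beta>. \<forall>x\<in>N \<beta>. \<forall>y\<in>N \<beta>. \<forall>c. (\<lambda>l. x l + c * y l) \<in> N \<beta>) \<and>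
     (\<forall>\<beta> \<beta>'. mdvd \<beta> \<beta>' \<longrightarrow> N \<beta> \<subseteq> N \<beta>') \<and>
     (\<forall>\<beta>. \<forall>y\<in>N \<beta>. \<forall>l\<ge>r. y l = 0)"

text \<open>A generator is a pair of multidegree and coefficient vector. Multiplication by a
  monomial changes the degree but not the coefficient vector, so in degree \<beta> a combination
  over the base field of generators whose degree divides \<beta> is all that is needed.\<close>

definition generates ::
  "(('n \<Rightarrow>\<^sub>0 nat) \<times> (nat \<Rightarrow> 'a::field)) set \<Rightarrow> (('n \<Rightarrow>\<^sub>0 nat) \<Rightarrow> (nat \<Rightarrow> 'a) set) \<Rightarrow> bool" where
  "generates G N \<longleftrightarrow> finite G \<and> (\<forall>g\<in>G. snd g \<in> N (fst g)) \<and>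
     (\<forall>\<beta>. \<forall>y\<in>N \<beta>. \<exists>z. (\<forall>g. z g \<noteq> 0 \<longrightarrow> g \<in> G \<and> mdvd (fst g) \<beta>) \<and>
        (\<forall>k. y k = (\<Sum>g\<in>G. z g * snd g k)))"

lemma generatesE:
  assumes "generates G N" "y \<in> N \<beta>"
  obtains z where "\<forall>g. z g \<noteq> 0 \<longrightarrow> g \<in> G \<and> mdvd (fst g) \<beta>"
    "\<forall>k. y k = (\<Sum>g\<in>G. z g * snd g k)"
proof -
  have "\<exists>z. (\<forall>g. z g \<noteq> 0 \<longrightarrow> g \<in> G \<and> mdvd (fst g) \<beta>) \<and>
      (\<forall>k. y k = (\<Sum>g\<in>G. z g * snd g k))"
    using assms unfolding generates_def by (elim conjE) (drule spec, erule (1) bspec)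
  with that show thesis by blast
qed

text \<open>The extension step for the induction on the rank: subtracting one multiple of one new
  generator moves a vector of \<open>M\<close> into the subfamily \<open>N\<close>, which is already
  generated by \<open>G\<close>.\<close>

lemma generates_superset:
  assumes G: "generates G N" and "finite H" "\<forall>h\<in>H. snd h \<in> M (fst h)"
    and "\<forall>\<beta>. N \<beta> \<subseteq> M \<beta>"
    and red: "\<And>\<beta> y. y \<in> M \<beta> \<Longrightarrow>
      y \<in> N \<beta> \<or> (\<exists>h\<in>H. \<exists>c. mdvd (fst h) \<beta> \<and> (\<lambda>k. y k - c * snd h k) \<in> N \<beta>)"
  shows "generates (G \<union> H) M"
  unfolding generates_def
proof (intro conjI ballI allI)
  show fin: "finite (G \<union> H)" using assms by (simp add: generates_def)
  show "snd g \<in> M (fst g)" if "g \<in> G \<union> H" for g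
    using that assms unfolding generates_def by blast
  have N: "\<exists>z. (\<forall>g. z g \<noteq> 0 \<longrightarrow> g \<in> G \<union> H \<and> mdvd (fst g) \<beta>) \<and>
        (\<forall>k. y k = (\<Sum>g\<in>G \<union> H. z g * snd g k))" if y: "y \<in> N \<beta>" for y \<beta>
  proof -
    obtain z where z: "\<forall>g. z g \<noteq> 0 \<longrightarrow> g \<in> G \<and> mdvd (fst g) \<beta>"
      "\<forall>k. y k = (\<Sum>g\<in>G. z g * snd g k)"
      using generatesE[OF G y] .
    have "(\<Sum>g\<in>G. z g * snd g k) = (\<Sum>g\<in>G \<union> H. z g * snd g k)" for k
      by (rule sum.mono_neutral_left) (use fin z(1) in auto)
    with z show ?thesis by auto
  qed
  fix \<beta> y
  assume "y \<in> M \<beta>"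
  from red[OF this] consider "y \<in> N \<beta>"
    | h c where "h \<in> H" "mdvd (fst h) \<beta>" "(\<lambda>k. y k - c * snd h k) \<in> N \<beta>" by blast
  then show "\<exists>z. (\<forall>g. z g \<noteq> 0 \<longrightarrow> g \<in> G \<union> H \<and> mdvd (fst g) \<beta>) \<and>
        (\<forall>k. y k = (\<Sum>g\<in>G \<union> H. z g * snd g k))"
  proof cases
    case 1
    then show ?thesis by (rule N)
  next
    case 2
    obtain z where z: "\<forall>g. z g \<noteq> 0 \<longrightarrow> g \<in> G \<union> H \<and> mdvd (fst g) \<beta>"
      "\<forall>k. y k - c * snd h k = (\<Sum>g\<in>G \<union> H. z g * snd g k)"
      using N[OF 2(3)] by blast
    \<comment> \<open>\<open>h\<close> may also lie in \<open>G\<close>, so \<open>c\<close> is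
      added to its coefficient rather than assigned.\<close>
    define z' where "z' g = z g + (if g = h then c else 0)" for g
    have "(\<Sum>g\<in>G \<union> H. z' g * snd g k) = (\<Sum>g\<in>G \<union> H. z g * snd g k) + c * snd h k" for k
    proof -
      have "(\<Sum>g\<in>G \<union> H. z' g * snd g k) =
          (\<Sum>g\<in>G \<union> H. z g * snd g k + (if g = h then c * snd h k else 0))"
        by (rule sum.cong) (auto simp: z'_def algebra_simps)
      also have "\<dots> = (\<Sum>g\<in>G \<union> H. z g * snd g k) + (\<Sum>g\<in>G \<union> H. if g = h then c * snd h k else 0)"
        by (rule sum.distrib)
      also have "(\<Sum>g\<in>G \<union> H. if g = h then c * snd h k else 0) = c * snd h k"
        using fin 2(1) by (simp add: sum.delta)
      finally show ?thesis .
    qed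
    moreover have "y k = (\<Sum>g\<in>G \<union> H. z g * snd g k) + c * snd h k" for k
      using z(2)[rule_format, of k] by (simp add: algebra_simps)
    moreover have "g \<in> G \<union> H \<and> mdvd (fst g) \<beta>" if "z' g \<noteq> 0" for g
    proof (cases "g = h")
      case False
      with that have "z g \<noteq> 0" by (simp add: z'_def)
      with z(1) show ?thesis by blast
    qed (use 2 in auto)
    ultimately show ?thesis by (intro exI[of _ z']) auto
  qed
qed

text \<open>Induction on the rank: the last coordinate is handled by Dickson's lemma, and the
  vectors whose last coordinate vanishes form a family of smaller rank.\<close>

lemma finite_generation:
  fixes N :: "('n::finite \<Rightarrow>\<^sub>0 nat) \<Rightarrow> (nat \<Rightarrow> 'a::field) set"
  assumes "subspace_family r N"
  shows "\<exists>G. generates G N"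
  using assms
proof (induction r arbitrary: N)
  case 0
  then have "y = (\<lambda>_. 0)" if "y \<in> N \<beta>" for y \<beta>
    using that unfolding subspace_family_def by (simp add: fun_eq_iff)
  then have "generates {} N"
    unfolding generates_def by (auto intro!: exI[of _ "\<lambda>_. 0"])
  then show ?case ..
next
  case (Suc r)
  note N = Suc.prems[unfolded subspace_family_def]
  define N' where "N' \<beta> = {y\<in>N \<beta>. y r = 0}" for \<beta>
  have "\<forall>l\<ge>r. y l = 0" if "y \<in> N' \<beta>" for y \<beta>
  proof (intro allI impI)
    fix l
    assume "l \<ge> r"
    then consider "l = r" | "l \<ge> Suc r" by linarith
    then show "y l = 0"
      by cases (use that N in \<open>unfold N'_def, blast+\<close>)
  qed
  then have "subspace_family r N'"
    unfolding subspace_family_def using N by (simp add: N'_def) blast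
  then obtain G where G: "generates G N'" using Suc.IH by blast
  \<comment> \<open>\<open>E\<close> holds the degrees in which the last coordinate can be nonzero.
    Over a field one such vector in each degree of a Dickson basis of \<open>E\<close> suffices to
    clear that coordinate.\<close>
  define E where "E = {\<beta>. \<exists>y\<in>N \<beta>. y r \<noteq> 0}"
  obtain B where B: "finite B" "B \<subseteq> E" "\<forall>e\<in>E. \<exists>b\<in>B. mdvd b e"
    using dickson[of E] by blast
  have "\<exists>y. \<forall>b\<in>B. y b \<in> N b \<and> y b r \<noteq> 0"
    by (rule bchoice) (use B(2) in \<open>auto simp: E_def\<close>)
  then obtain Y where Y: "\<And>b. b \<in> B \<Longrightarrow> Y b \<in> N b" "\<And>b. b \<in> B \<Longrightarrow> Y b r \<noteq> 0"
    by blast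
  define H where "H = (\<lambda>b. (b, Y b)) ` B"
  have "generates (G \<union> H) N"
  proof (rule generates_superset[OF G])
    show "finite H" using B by (simp add: H_def)
    show "\<forall>h\<in>H. snd h \<in> N (fst h)" using Y by (auto simp: H_def)
    show "\<forall>\<beta>. N' \<beta> \<subseteq> N \<beta>" by (auto simp: N'_def)
    fix \<beta> y
    assume y: "y \<in> N \<beta>"
    show "y \<in> N' \<beta> \<or> (\<exists>h\<in>H. \<exists>c. mdvd (fst h) \<beta> \<and> (\<lambda>k. y k - c * snd h k) \<in> N' \<beta>)"
    proof (cases "y r = 0")
      case True
      with y show ?thesis by (simp add: N'_def)
    next
      case False
      with y B obtain b where b: "b \<in> B" "mdvd b \<beta>" by (auto simp: E_def)
      then have "Y b \<in> N \<beta>" using Y(1) N by blast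
      define c where "c = y r / Y b r"
      have "(\<lambda>l. y l + (- c) * Y b l) \<in> N \<beta>" using N y \<open>Y b \<in> N \<beta>\<close> by blast
      then have "(\<lambda>k. y k - c * Y b k) \<in> N' \<beta>"
        using Y(2)[OF b(1)] by (simp add: N'_def c_def)
      with b show ?thesis by (auto simp: H_def)
    qed
  qed
  then show ?case ..
qed

text \<open>In a relation of degree \<open>fst g0\<close> the generator \<open>g0\<close> has a scalar coefficient, so the
  relation can be solved for it.\<close>

lemma generates_remove:
  fixes N :: "('n::finite \<Rightarrow>\<^sub>0 nat) \<Rightarrow> (nat \<Rightarrow> 'a::field) set"
  assumes G: "generates G N" and g0: "g0 \<in> G" and z0: "z g0 \<noteq> 0"
    and z: "\<forall>g. z g \<noteq> 0 \<longrightarrow> g \<in> G \<and> mdvd (fst g) (fst g0)"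
    and rel: "\<forall>k. (\<Sum>g\<in>G. z g * snd g k) = 0"
  shows "generates (G - {g0}) N"
  unfolding generates_def
proof (intro conjI ballI allI)
  have fin: "finite G" using G by (simp add: generates_def)
  then show "finite (G - {g0})" by simp
  show "snd g \<in> N (fst g)" if "g \<in> G - {g0}" for g
    using that G by (auto simp: generates_def)
  fix \<beta> y
  assume y: "y \<in> N \<beta>"
  obtain w where w: "\<forall>g. w g \<noteq> 0 \<longrightarrow> g \<in> G \<and> mdvd (fst g) \<beta>"
    "\<forall>k. y k = (\<Sum>g\<in>G. w g * snd g k)"
    using generatesE[OF G y] .
  define w' where "w' g = w g - w g0 / z g0 * z g" for g
  have w'0: "w' g0 = 0" using z0 by (simp add: w'_def)
  have "g \<in> G - {g0} \<and> mdvd (fst g) \<beta>" if "w' g \<noteq> 0" for g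
  proof -
    have "g \<noteq> g0" using that w'0 by auto
    \<comment> \<open>The relation enters only if \<open>w g0\<close> is nonzero; then the degree of
      \<open>g0\<close> divides \<beta>, and hence so do all degrees occurring in the
      relation.\<close>
    moreover from that have "w g \<noteq> 0 \<or> w g0 \<noteq> 0 \<and> z g \<noteq> 0" by (auto simp: w'_def)
    ultimately show ?thesis using w(1) z by (blast intro: mdvd_trans)
  qed
  moreover have "y k = (\<Sum>g\<in>G - {g0}. w' g * snd g k)" for k
  proof -
    have "(\<Sum>g\<in>G - {g0}. w' g * snd g k) = (\<Sum>g\<in>G. w' g * snd g k)"
      by (rule sum.mono_neutral_left) (use fin w'0 in auto)
    also have "\<dots> = (\<Sum>g\<in>G. w g * snd g k - w g0 / z g0 * (z g * snd g k))"
      by (simp add: w'_def algebra_simps)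
    also have "\<dots> = (\<Sum>g\<in>G. w g * snd g k) - w g0 / z g0 * (\<Sum>g\<in>G. z g * snd g k)"
      by (simp add: sum_subtractf sum_distrib_left)
    also have "\<dots> = y k" using rel w(2) by simp
    finally show ?thesis by simp
  qed
  ultimately show "\<exists>z. (\<forall>g. z g \<noteq> 0 \<longrightarrow> g \<in> G - {g0} \<and> mdvd (fst g) \<beta>) \<and>
        (\<forall>k. y k = (\<Sum>g\<in>G - {g0}. z g * snd g k))"
    by blast
qed

text \<open>Admissible coefficient vectors for the degree \<beta> part of the free module: the basis
  element of degree \<open>b l\<close> has a multiple there only if \<open>b l\<close> divides
  \<beta>.\<close>

definition supported ::
  "nat \<Rightarrow> (nat \<Rightarrow> ('n \<Rightarrow>\<^sub>0 nat)) \<Rightarrow> ('n \<Rightarrow>\<^sub>0 nat) \<Rightarrow> (nat \<Rightarrow> 'a::zero) \<Rightarrow> bool" where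
  "supported r b \<beta> z \<longleftrightarrow> (\<forall>l. z l \<noteq> 0 \<longrightarrow> l < r \<and> mdvd (b l) \<beta>)"

text \<open>Take a generating set of least cardinality. A relation with a nonzero scalar coefficient
  at a generator of the degree of that relation would make the generator removable; this is how
  minimality of the resolution enters.\<close>

lemma minimal_cover:
  fixes N :: "('n::finite \<Rightarrow>\<^sub>0 nat) \<Rightarrow> (nat \<Rightarrow> 'a::field) set"
  assumes N: "subspace_family r N"
  shows "\<exists>r' b' c. (\<forall>k l. c k l \<noteq> 0 \<longrightarrow> l < r') \<and> (\<forall>l<r'. (\<lambda>k. c k l) \<in> N (b' l)) \<and>
     (\<forall>\<beta>. \<forall>y\<in>N \<beta>. \<exists>z. supported r' b' \<beta> z \<and> (\<forall>k. y k = (\<Sum>l<r'. c k l * z l))) \<and>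
     (\<forall>\<beta> z l. supported r' b' \<beta> z \<and> (\<forall>k. (\<Sum>l<r'. c k l * z l) = 0) \<and> z l \<noteq> 0 \<longrightarrow> b' l \<noteq> \<beta>)"
proof -
  obtain G where G: "generates G N" and min: "\<And>G'. generates G' N \<Longrightarrow> card G \<le> card G'"
    using ex_has_least_nat[of "\<lambda>G. generates G N" _ card] finite_generation[OF N] by blast
  have fin: "finite G" using G by (simp add: generates_def)
  define r' where "r' = card G"
  obtain h where h: "bij_betw h {..<r'} G"
    using ex_bij_betw_nat_finite[OF fin] by (auto simp: r'_def atLeast0LessThan)
  define b' where "b' l = fst (h l)" for l
  define c where "c k l = (if l < r' then snd (h l) k else 0)" for k l
  have sum_h: "(\<Sum>l<r'. c k l * w (h l)) = (\<Sum>g\<in>G. w g * snd g k)" for w k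
    unfolding sum.reindex_bij_betw[OF h, symmetric] by (rule sum.cong) (auto simp: c_def)
  have hG: "h l \<in> G" if "l < r'" for l using h that by (auto simp: bij_betw_def)
  have inj: "inj_on h {..<r'}" using h by (simp add: bij_betw_def)
  have "(\<lambda>k. c k l) \<in> N (b' l)" if "l < r'" for l
    using G hG[OF that] that by (simp add: generates_def c_def b'_def)
  moreover have "\<exists>z. supported r' b' \<beta> z \<and> (\<forall>k. y k = (\<Sum>l<r'. c k l * z l))"
    if "y \<in> N \<beta>" for y \<beta>
  proof -
    obtain w where w: "\<forall>g. w g \<noteq> 0 \<longrightarrow> g \<in> G \<and> mdvd (fst g) \<beta>"
      "\<forall>k. y k = (\<Sum>g\<in>G. w g * snd g k)"
      using generatesE[OF G \<open>y \<in> N \<beta>\<close>] .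
    define z where "z l = (if l < r' then w (h l) else 0)" for l
    have "(\<Sum>l<r'. c k l * z l) = (\<Sum>l<r'. c k l * w (h l))" for k
      by (rule sum.cong) (auto simp: z_def)
    moreover have "supported r' b' \<beta> z"
      using w(1) by (simp add: supported_def z_def b'_def del: split_paired_All)
    ultimately show ?thesis using w(2) sum_h by auto
  qed
  moreover have "b' l \<noteq> \<beta>"
    if z: "supported r' b' \<beta> z" "\<forall>k. (\<Sum>l<r'. c k l * z l) = 0" "z l \<noteq> 0" for \<beta> z l
  proof
    assume eq: "b' l = \<beta>"
    have l: "l < r'" using z by (auto simp: supported_def)
    define w where "w g = (if g \<in> G then z (the_inv_into {..<r'} h g) else 0)" for g
    have wh: "w (h m) = z m" if "m < r'" for m
      using that hG inj by (simp add: w_def the_inv_into_f_f)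
    have "generates (G - {h l}) N"
    proof (rule generates_remove[OF G hG[OF l]])
      show "w (h l) \<noteq> 0" using z(3) wh l by simp
      show "\<forall>g. w g \<noteq> 0 \<longrightarrow> g \<in> G \<and> mdvd (fst g) (fst (h l))"
      proof (intro allI impI)
        fix g
        assume g: "w g \<noteq> 0"
        then have "g \<in> G" by (auto simp: w_def split: if_splits)
        with h obtain m where m: "m < r'" "g = h m" by (auto simp: bij_betw_def)
        with g z(1) have "mdvd (b' m) \<beta>" by (auto simp: wh supported_def)
        with eq m \<open>g \<in> G\<close> show "g \<in> G \<and> mdvd (fst g) (fst (h l))" by (simp add: b'_def)
      qed
      have "(\<Sum>l<r'. c k l * w (h l)) = (\<Sum>l<r'. c k l * z l)" for k
        by (rule sum.cong) (auto simp: wh)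
      then show "\<forall>k. (\<Sum>g\<in>G. w g * snd g k) = 0" using z(2) sum_h by auto
    qed
    from min[OF this] hG[OF l] fin show False
      by (metis card_Diff1_less leD)
  qed
  moreover have "l < r'" if "c k l \<noteq> 0" for k l
    using that by (auto simp: c_def split: if_splits)
  ultimately show ?thesis by blast
qed

subsection \<open>Coefficients of products\<close>

lemma lookup_single_mult:
  fixes p :: "('n, 'a::field) mpoly"
  shows "lookup (Poly_Mapping.single e c * p) m = (if mdvd e m then c * lookup p (m - e) else 0)"
proof -
  have eq: "m = e + q \<longleftrightarrow> mdvd e m \<and> q = m - e" for q
    by (metis mdvd_add(1) mdvd_add_diff add_diff_cancel_left')
  have "lookup (Poly_Mapping.single e c * p) m =
      (\<Sum>l. (c when e = l) * (\<Sum>q. lookup p q when m = l + q))"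
    by (simp add: lookup_mult lookup_single)
  also have "\<dots> = (\<Sum>l. c * (\<Sum>q. lookup p q when m = l + q) when e = l)"
    by (simp add: when_mult)
  also have "\<dots> = c * (\<Sum>q. lookup p q when m = e + q)"
    by (simp add: Sum_any_when_equal')
  also have "(\<Sum>q. lookup p q when m = e + q) = (if mdvd e m then lookup p (m - e) else 0)"
    by (simp add: eq)
  finally show ?thesis by simp
qed

text \<open>Only the pair \<open>p0\<close>, \<open>q0\<close> can contribute to the convolution at
  \<open>p0 + q0\<close>; splitting the \<open>p0\<close> term off \<open>f\<close> isolates that
  contribution.\<close>

lemma lookup_mult_unique:
  fixes f g :: "('n, 'a::field) mpoly"
  assumes uniq: "\<And>p q. p + q = p0 + q0 \<Longrightarrow> lookup f p \<noteq> 0 \<Longrightarrow> lookup g q \<noteq> 0 \<Longrightarrow> p = p0"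
  shows "lookup (f * g) (p0 + q0) = lookup f p0 * lookup g q0"
proof -
  define f' where "f' = f - Poly_Mapping.single p0 (lookup f p0)"
  have f: "f = Poly_Mapping.single p0 (lookup f p0) + f'" by (simp add: f'_def)
  have f'0: "lookup f' p0 = 0" by (simp add: f'_def lookup_minus)
  have f'1: "lookup f' p = lookup f p" if "p \<noteq> p0" for p
    using that by (simp add: f'_def lookup_minus lookup_single)
  have "p0 + q0 \<notin> keys (f' * g)"
  proof
    assume "p0 + q0 \<in> keys (f' * g)"
    then obtain p q where pq: "p0 + q0 = p + q" "lookup f' p \<noteq> 0" "lookup g q \<noteq> 0"
      using keys_mult[of f' g] by (auto simp: in_keys_iff)
    then have "p \<noteq> p0" using f'0 by auto
    with pq uniq[of p q] f'1 show False by auto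
  qed
  then have "lookup (f' * g) (p0 + q0) = 0" by (simp add: in_keys_iff)
  moreover have "f * g = Poly_Mapping.single p0 (lookup f p0) * g + f' * g"
    by (subst f) (simp add: distrib_right)
  ultimately show ?thesis
    by (simp add: lookup_add lookup_single_mult)
qed

subsection \<open>Monomial matrices\<close>

text \<open>The coefficient vector of the component of multidegree \<beta> of \<open>x\<close>. The
  divisibility test guards against truncated subtraction of exponents.\<close>

definition homog_part ::
  "(nat \<Rightarrow> ('n \<Rightarrow>\<^sub>0 nat)) \<Rightarrow> ('n \<Rightarrow>\<^sub>0 nat) \<Rightarrow> (nat \<Rightarrow> ('n, 'a::field) mpoly) \<Rightarrow> nat \<Rightarrow> 'a" where
  "homog_part b \<beta> x l = (if mdvd (b l) \<beta> then lookup (x l) (\<beta> - b l) else 0)"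

lemma homog_part_add: "homog_part b (m + b l) x l = lookup (x l) m"
  by (simp add: homog_part_def)

lemma homog_part_eqI:
  assumes "\<And>\<beta>. homog_part b \<beta> x l = homog_part b \<beta> y l"
  shows "x l = y l"
  by (rule poly_mapping_eqI) (metis assms homog_part_add)

text \<open>A map preserving multidegrees can only have such entries: a scalar times the monomial
  quotient of the source degree by the target degree.\<close>

definition mono_matrix ::
  "(nat \<Rightarrow> ('n \<Rightarrow>\<^sub>0 nat)) \<Rightarrow> (nat \<Rightarrow> ('n \<Rightarrow>\<^sub>0 nat)) \<Rightarrow> (nat \<Rightarrow> nat \<Rightarrow> 'a) \<Rightarrow> nat \<Rightarrow> nat \<Rightarrow> ('n, 'a::field) mpoly"
  where "mono_matrix b b' c k l = Poly_Mapping.single (b' l - b k) (c k l)"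

lemma mdvd_diff_iff:
  assumes "mdvd a b"
  shows "mdvd (b - a) m \<longleftrightarrow> mdvd b (m + a)"
proof -
  have "(lookup b i - lookup a i \<le> lookup m i) = (lookup b i \<le> lookup m i + lookup a i)" for i
    using assms unfolding mdvd_def by (metis le_diff_conv)
  then show ?thesis by (simp add: mdvd_def lookup_minus lookup_add)
qed

lemma diff_diff_eq_mono:
  assumes "mdvd a b" "mdvd b (m + a)"
  shows "m - (b - a) = (m + a) - b"
proof (rule poly_mapping_eqI)
  fix i
  have "lookup a i \<le> lookup b i" "lookup b i \<le> lookup m i + lookup a i"
    using assms by (auto simp: mdvd_def lookup_add)
  then show "lookup (m - (b - a)) i = lookup (m + a - b) i"
    by (simp add: lookup_minus lookup_add)
qed

lemma lookup_mono_matrix_mult: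
  assumes c: "\<And>k l. c k l \<noteq> 0 \<Longrightarrow> mdvd (b k) (b' l)"
  shows "lookup (\<Sum>l<r'. mono_matrix b b' c k l * x l) m =
    (\<Sum>l<r'. c k l * homog_part b' (m + b k) x l)"
proof -
  have "lookup (mono_matrix b b' c k l * x l) m = c k l * homog_part b' (m + b k) x l" for l
  proof (cases "c k l = 0")
    case False
    note d = c[OF this]
    show ?thesis
      by (simp add: mono_matrix_def lookup_single_mult homog_part_def mdvd_diff_iff[OF d]
          diff_diff_eq_mono[OF d])
  qed (simp add: mono_matrix_def)
  then show ?thesis by (simp add: lookup_sum)
qed

text \<open>In every multidegree the polynomial matrix acts through the same scalar matrix
  \<open>c\<close>; this turns exactness into linear algebra.\<close>

lemma homog_part_mono_matrix:
  assumes c: "\<And>k l. c k l \<noteq> 0 \<Longrightarrow> l < r' \<and> k < r \<and> mdvd (b k) (b' l)"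
  shows "homog_part b \<beta> (\<lambda>k. if k < r then \<Sum>l<r'. mono_matrix b b' c k l * x l else 0) k =
    (\<Sum>l<r'. c k l * homog_part b' \<beta> x l)"
proof (cases "k < r \<and> mdvd (b k) \<beta>")
  case True
  have "lookup (\<Sum>l<r'. mono_matrix b b' c k l * x l) (\<beta> - b k) =
      (\<Sum>l<r'. c k l * homog_part b' (\<beta> - b k + b k) x l)"
    by (rule lookup_mono_matrix_mult) (use c in blast)
  with True show ?thesis by (simp add: homog_part_def[of b] mdvd_diff_add)
next
  case False
  \<comment> \<open>If \<open>b k\<close> does not divide \<beta>, neither does any multiple
    \<open>b' l\<close> of it, so each term has a vanishing factor.\<close>
  have "c k l * homog_part b' \<beta> x l = 0" for l
    using c[of k l] False by (auto simp: homog_part_def intro: mdvd_trans)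
  then have "(\<Sum>l<r'. c k l * homog_part b' \<beta> x l) = 0" by (simp add: sum.neutral)
  with False show ?thesis by (auto simp: homog_part_def)
qed

lemma supported_homog_part:
  assumes "\<forall>l. r \<le> l \<longrightarrow> x l = 0"
  shows "supported r b \<beta> (homog_part b \<beta> x)"
  using assms by (auto simp: supported_def homog_part_def not_le[symmetric] split: if_splits)

lemma mono_matrix_kernel:
  assumes c: "\<And>k l. c k l \<noteq> 0 \<Longrightarrow> l < r' \<and> k < r \<and> mdvd (b k) (b' l)"
  shows "(\<lambda>k. if k < r then \<Sum>l<r'. mono_matrix b b' c k l * x l else 0) = (\<lambda>_. 0) \<longleftrightarrow>
    (\<forall>\<beta> k. (\<Sum>l<r'. c k l * homog_part b' \<beta> x l) = 0)" (is "?y = _ \<longleftrightarrow> ?R")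
proof -
  have hp: "homog_part b \<beta> ?y k = (\<Sum>l<r'. c k l * homog_part b' \<beta> x l)" for \<beta> k
    by (rule homog_part_mono_matrix) (rule c)
  show ?thesis
  proof
    assume "?y = (\<lambda>_. 0)"
    then have "homog_part b \<beta> ?y k = 0" for \<beta> k
      by (simp only: homog_part_def lookup_zero if_cancel)
    then show ?R by (simp add: hp)
  next
    assume R: ?R
    have "?y k = (\<lambda>_. 0) k" for k
    proof (rule homog_part_eqI[where x = ?y and y = "\<lambda>_. 0" and b = b])
      show "homog_part b \<beta> ?y k = homog_part b \<beta> (\<lambda>_. 0) k" for \<beta>
        unfolding hp using R by (simp add: homog_part_def)
    qed
    then show "?y = (\<lambda>_. 0)" by blast
  qed
qed

text \<open>Finitely many homogeneous parts glue to one vector of polynomials: for fixed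
  \<open>l\<close>, distinct degrees divisible by \<open>b l\<close> give distinct exponents, so the
  terms do not interfere.\<close>

lemma ex_homog_parts:
  assumes fin: "finite B" and Z: "\<And>\<beta>. supported r b \<beta> (Z \<beta>)" and Z0: "\<And>\<beta>. \<beta> \<notin> B \<Longrightarrow> Z \<beta> = (\<lambda>_. 0)"
  shows "\<exists>x :: nat \<Rightarrow> ('n, 'a::field) mpoly. (\<forall>l. r \<le> l \<longrightarrow> x l = 0) \<and> (\<forall>\<beta>. homog_part b \<beta> x = Z \<beta>)"
proof -
  define x where "x l = (\<Sum>\<beta>\<in>{\<beta>\<in>B. mdvd (b l) \<beta>}. Poly_Mapping.single (\<beta> - b l) (Z \<beta> l))" for l
  have "x l = 0" if "r \<le> l" for l
  proof -
    have "Z \<beta> l = 0" for \<beta> using Z[of \<beta>] that by (auto simp: supported_def)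
    then show ?thesis by (simp add: x_def)
  qed
  moreover have "homog_part b \<beta> x l = Z \<beta> l" for \<beta> l
  proof (cases "mdvd (b l) \<beta>")
    case True
    have eq: "\<beta>' - b l = \<beta> - b l \<longleftrightarrow> \<beta>' = \<beta>" if "mdvd (b l) \<beta>'" for \<beta>'
      using that True by (metis mdvd_add_diff)
    have "lookup (x l) (\<beta> - b l) =
        (\<Sum>\<beta>'\<in>{\<beta>\<in>B. mdvd (b l) \<beta>}. Z \<beta>' l when \<beta>' - b l = \<beta> - b l)"
      by (simp add: x_def lookup_sum lookup_single)
    also have "\<dots> = (\<Sum>\<beta>'\<in>{\<beta>\<in>B. mdvd (b l) \<beta>}. if \<beta>' = \<beta> then Z \<beta> l else 0)"
      by (rule sum.cong) (auto simp: eq when_def)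
    also have "\<dots> = Z \<beta> l"
      using fin True Z0[of \<beta>] by (auto simp: sum.delta)
    finally show ?thesis using True by (simp add: homog_part_def)
  next
    case False
    then show ?thesis using Z[of \<beta>] by (auto simp: homog_part_def supported_def)
  qed
  ultimately show ?thesis by blast
qed

lemma finite_homog_parts:
  assumes "\<forall>l. r \<le> l \<longrightarrow> x l = 0"
  shows "finite {\<beta>. homog_part b \<beta> x \<noteq> (\<lambda>_. 0)}"
proof (rule finite_subset)
  show "{\<beta>. homog_part b \<beta> x \<noteq> (\<lambda>_. 0)} \<subseteq> (\<Union>l<r. (\<lambda>m. b l + m) ` keys (x l))"
  proof
    fix \<beta>
    assume "\<beta> \<in> {\<beta>. homog_part b \<beta> x \<noteq> (\<lambda>_. 0)}"
    then obtain l where "homog_part b \<beta> x l \<noteq> 0" by auto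
    then have l: "mdvd (b l) \<beta>" "lookup (x l) (\<beta> - b l) \<noteq> 0"
      by (auto simp: homog_part_def split: if_splits)
    moreover have "l < r" using l(2) assms by (metis lookup_zero not_le)
    moreover have "\<beta> = b l + (\<beta> - b l)" using l(1) by (simp add: mdvd_add_diff)
    ultimately show "\<beta> \<in> (\<Union>l<r. (\<lambda>m. b l + m) ` keys (x l))"
      by (intro UN_I[of l] image_eqI[of _ _ "\<beta> - b l"]) (simp_all add: in_keys_iff)
  qed
qed simp

text \<open>Preimages may be chosen degree by degree and glued, since only finitely many homogeneous
  parts of \<open>y\<close> are nonzero.\<close>

lemma mono_matrix_image:
  assumes c: "\<And>k l. c k l \<noteq> 0 \<Longrightarrow> l < r' \<and> k < r \<and> mdvd (b k) (b' l)"
    and y: "\<forall>k. r \<le> k \<longrightarrow> y k = 0"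
  shows "(\<exists>x. (\<forall>l. r' \<le> l \<longrightarrow> x l = 0) \<and>
      y = (\<lambda>k. if k < r then \<Sum>l<r'. mono_matrix b b' c k l * x l else 0)) \<longleftrightarrow>
    (\<forall>\<beta>. \<exists>z. supported r' b' \<beta> z \<and> (\<forall>k. homog_part b \<beta> y k = (\<Sum>l<r'. c k l * z l)))"
    (is "?L \<longleftrightarrow> ?R")
proof
  assume ?L
  then obtain x where x: "\<forall>l. r' \<le> l \<longrightarrow> x l = 0"
    "y = (\<lambda>k. if k < r then \<Sum>l<r'. mono_matrix b b' c k l * x l else 0)" by blast
  show ?R
  proof
    fix \<beta>
    have "homog_part b \<beta> y k = (\<Sum>l<r'. c k l * homog_part b' \<beta> x l)" for k
      unfolding x(2) by (rule homog_part_mono_matrix[OF c])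
    with supported_homog_part[OF x(1)]
    show "\<exists>z. supported r' b' \<beta> z \<and> (\<forall>k. homog_part b \<beta> y k = (\<Sum>l<r'. c k l * z l))"
      by blast
  qed
next
  assume R: ?R
  have hp: "homog_part b \<beta> (\<lambda>k. if k < r then \<Sum>l<r'. mono_matrix b b' c k l * x l else 0) k =
      (\<Sum>l<r'. c k l * homog_part b' \<beta> x l)" for \<beta> k x
    by (rule homog_part_mono_matrix) (rule c)
  define B where "B = {\<beta>. homog_part b \<beta> y \<noteq> (\<lambda>_. 0)}"
  have "\<exists>Z. \<forall>\<beta>. supported r' b' \<beta> (Z \<beta>) \<and> (\<forall>k. homog_part b \<beta> y k = (\<Sum>l<r'. c k l * Z \<beta> l))"
    using R by (rule choice)
  then obtain Z where Z: "\<And>\<beta>. supported r' b' \<beta> (Z \<beta>)"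
    "\<And>\<beta> k. homog_part b \<beta> y k = (\<Sum>l<r'. c k l * Z \<beta> l)" by blast
  \<comment> \<open>The choice \<open>Z\<close> may return nonzero kernel vectors in infinitely many
    degrees; resetting it to zero outside \<open>B\<close> makes gluing possible.\<close>
  define Z' where "Z' \<beta> = (if \<beta> \<in> B then Z \<beta> else (\<lambda>_. 0))" for \<beta>
  have "\<exists>x. (\<forall>l. r' \<le> l \<longrightarrow> x l = 0) \<and> (\<forall>\<beta>. homog_part b' \<beta> x = Z' \<beta>)"
  proof (rule ex_homog_parts)
    show "finite B" unfolding B_def by (rule finite_homog_parts[OF y])
    show "supported r' b' \<beta> (Z' \<beta>)" for \<beta>
      using Z(1) by (simp add: Z'_def supported_def)
  qed (simp add: Z'_def)
  then obtain x where x: "\<forall>l. r' \<le> l \<longrightarrow> x l = 0" "\<And>\<beta>. homog_part b' \<beta> x = Z' \<beta>" by blast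
  let ?y = "\<lambda>k. if k < r then \<Sum>l<r'. mono_matrix b b' c k l * x l else 0"
  have "y k = ?y k" for k
  proof (rule homog_part_eqI[where x = y and y = ?y and b = b])
    fix \<beta>
    have "homog_part b \<beta> y k = (\<Sum>l<r'. c k l * Z' \<beta> l)"
    proof (cases "\<beta> \<in> B")
      case False
      then have "homog_part b \<beta> y k = 0" by (simp add: B_def)
      with False show ?thesis by (simp add: Z'_def)
    qed (simp add: Z Z'_def)
    then show "homog_part b \<beta> y k = homog_part b \<beta> ?y k"
      by (simp only: hp x(2))
  qed
  with x(1) show ?L by blast
qed

subsection \<open>Existence of minimal graded free resolutions of monomial ideals\<close>

definition kernel_family ::
  "nat \<Rightarrow> (nat \<Rightarrow> ('n \<Rightarrow>\<^sub>0 nat)) \<Rightarrow> (nat \<Rightarrow> nat \<Rightarrow> 'a::field) \<Rightarrow> ('n \<Rightarrow>\<^sub>0 nat) \<Rightarrow> (nat \<Rightarrow> 'a) set" where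
  "kernel_family r b c \<beta> = {z. supported r b \<beta> z \<and> (\<forall>k. (\<Sum>l<r. c k l * z l) = 0)}"

lemma subspace_kernel_family: "subspace_family r (kernel_family r b c)"
  unfolding subspace_family_def
proof (intro conjI allI ballI impI)
  show "(\<lambda>_. 0) \<in> kernel_family r b c \<beta>" for \<beta>
    by (simp add: kernel_family_def supported_def)
  fix \<beta> x y d
  assume xy: "x \<in> kernel_family r b c \<beta>" "y \<in> kernel_family r b c \<beta>"
  have "(\<Sum>l<r. c k l * (x l + d * y l)) = (\<Sum>l<r. c k l * x l) + d * (\<Sum>l<r. c k l * y l)" for k
    by (simp add: sum.distrib sum_distrib_left algebra_simps)
  moreover have "supported r b \<beta> (\<lambda>l. x l + d * y l)"
    unfolding supported_def
  proof (intro allI impI)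
    fix l
    assume "x l + d * y l \<noteq> 0"
    then have "x l \<noteq> 0 \<or> y l \<noteq> 0" by auto
    with xy show "l < r \<and> mdvd (b l) \<beta>" by (auto simp: kernel_family_def supported_def)
  qed
  ultimately show "(\<lambda>l. x l + d * y l) \<in> kernel_family r b c \<beta>"
    using xy by (simp add: kernel_family_def)
next
  fix \<beta> \<beta>' :: "'a \<Rightarrow>\<^sub>0 nat"
  assume "mdvd \<beta> \<beta>'"
  then show "kernel_family r b c \<beta> \<subseteq> kernel_family r b c \<beta>'"
    unfolding kernel_family_def supported_def by (blast intro: mdvd_trans)
next
  fix \<beta> y l
  assume "y \<in> kernel_family r b c \<beta>" "r \<le> l"
  then show "y l = 0" by (auto simp: kernel_family_def supported_def)
qed

text \<open>A stage \<open>(r, b, c, N)\<close> of the resolution: a free module of rank \<open>r\<close> with basis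
  degrees \<open>b\<close>, the matrix \<open>c\<close> of the differential leaving it, and the submodule \<open>N\<close>
  of the free module that the next stage has to cover.\<close>

type_synonym ('n, 'a) stage =
  "nat \<times> (nat \<Rightarrow> ('n \<Rightarrow>\<^sub>0 nat)) \<times> (nat \<Rightarrow> nat \<Rightarrow> 'a) \<times> (('n \<Rightarrow>\<^sub>0 nat) \<Rightarrow> (nat \<Rightarrow> 'a) set)"

fun stage_ok :: "('n, 'a::field) stage \<Rightarrow> bool" where
  "stage_ok (r, b, c, N) \<longleftrightarrow> subspace_family r N \<and> (\<forall>\<beta>. \<forall>y\<in>N \<beta>. supported r b \<beta> y)"

text \<open>The clauses say that the new matrix is multigraded, has image \<open>N\<close> and
  kernel \<open>N'\<close>, and that no kernel element has a scalar coefficient at a basis element.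
  The last one keeps constants out of the next differential.\<close>

fun stage_step :: "('n, 'a::field) stage \<Rightarrow> ('n, 'a) stage \<Rightarrow> bool" where
  "stage_step (r, b, c, N) (r', b', c', N') \<longleftrightarrow>
     (\<forall>k l. c' k l \<noteq> 0 \<longrightarrow> l < r' \<and> k < r \<and> mdvd (b k) (b' l)) \<and>
     (\<forall>\<beta> y. y \<in> N \<beta> \<longleftrightarrow> (\<exists>z. supported r' b' \<beta> z \<and> (\<forall>k. y k = (\<Sum>l<r'. c' k l * z l)))) \<and>
     (\<forall>\<beta> z. z \<in> N' \<beta> \<longleftrightarrow> z \<in> kernel_family r' b' c' \<beta>) \<and>
     (\<forall>\<beta>. \<forall>z\<in>N' \<beta>. \<forall>l. z l \<noteq> 0 \<longrightarrow> b' l \<noteq> \<beta>)"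

lemma subspace_family_sum:
  assumes N: "subspace_family r N" and "finite L" "\<And>l. l \<in> L \<Longrightarrow> z l \<noteq> 0 \<Longrightarrow> (\<lambda>k. c k l) \<in> N \<beta>"
  shows "(\<lambda>k. \<Sum>l\<in>L. c k l * z l) \<in> N \<beta>"
  using assms(2,3)
proof (induction L)
  case empty
  then show ?case using N by (simp add: subspace_family_def)
next
  case (insert a L)
  show ?case
  proof (cases "z a = 0")
    case True
    with insert show ?thesis by simp
  next
    case False
    have "(\<lambda>k. \<Sum>l\<in>L. c k l * z l) \<in> N \<beta>" using insert by simp
    moreover have "(\<lambda>k. c k a) \<in> N \<beta>" using insert False by simp
    ultimately have "(\<lambda>k. (\<Sum>l\<in>L. c k l * z l) + z a * c k a) \<in> N \<beta>"
      using N by (simp add: subspace_family_def)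
    with insert.hyps show ?thesis by (simp add: algebra_simps)
  qed
qed

text \<open>A minimal cover of \<open>N\<close> supplies the differential. Its columns lie in
  \<open>N (b' l)\<close>, which forces the divisibility of degrees and, by closure of
  \<open>N\<close>, places the whole image in \<open>N\<close>.\<close>

lemma ex_stage_step:
  fixes s :: "('n::finite, 'a::field) stage"
  assumes "stage_ok s"
  shows "\<exists>s'. stage_ok s' \<and> stage_step s s'"
proof -
  obtain r b c N where s: "s = (r, b, c, N)" by (cases s)
  have N: "subspace_family r N" and supp: "\<forall>\<beta>. \<forall>y\<in>N \<beta>. supported r b \<beta> y"
    using assms s by auto
  obtain r' b' c' where
    c': "\<forall>k l. c' k l \<noteq> 0 \<longrightarrow> l < r'" and
    col: "\<forall>l<r'. (\<lambda>k. c' k l) \<in> N (b' l)" and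
    gen: "\<forall>\<beta>. \<forall>y\<in>N \<beta>. \<exists>z. supported r' b' \<beta> z \<and> (\<forall>k. y k = (\<Sum>l<r'. c' k l * z l))" and
    min: "\<forall>\<beta> z l. supported r' b' \<beta> z \<and> (\<forall>k. (\<Sum>l<r'. c' k l * z l) = 0) \<and> z l \<noteq> 0 \<longrightarrow> b' l \<noteq> \<beta>"
    using minimal_cover[OF N] by (elim exE conjE)
  have c'1: "l < r' \<and> k < r \<and> mdvd (b k) (b' l)" if "c' k l \<noteq> 0" for k l
  proof -
    have l: "l < r'" using c' that by blast
    with col supp have "supported r b (b' l) (\<lambda>k. c' k l)" by blast
    with that l show ?thesis by (auto simp: supported_def)
  qed
  have in_N: "y \<in> N \<beta>"
    if z: "supported r' b' \<beta> z" and y: "\<forall>k. y k = (\<Sum>l<r'. c' k l * z l)" for y \<beta> z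
  proof -
    have "(\<lambda>k. \<Sum>l<r'. c' k l * z l) \<in> N \<beta>"
    proof (rule subspace_family_sum[OF N])
      fix l
      assume "l \<in> {..<r'}" "z l \<noteq> 0"
      with z col have "(\<lambda>k. c' k l) \<in> N (b' l)" "mdvd (b' l) \<beta>" by (auto simp: supported_def)
      with N show "(\<lambda>k. c' k l) \<in> N \<beta>" unfolding subspace_family_def by blast
    qed simp
    moreover have "y = (\<lambda>k. \<Sum>l<r'. c' k l * z l)" using y by blast
    ultimately show ?thesis by simp
  qed
  have "stage_step s (r', b', c', kernel_family r' b' c')"
    unfolding s stage_step.simps
  proof (intro conjI allI ballI impI)
    fix \<beta> y
    show "y \<in> N \<beta> \<longleftrightarrow> (\<exists>z. supported r' b' \<beta> z \<and> (\<forall>k. y k = (\<Sum>l<r'. c' k l * z l)))"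
      using gen in_N by blast
  next
    fix \<beta> z l
    assume "z \<in> kernel_family r' b' c' \<beta>" "z l \<noteq> 0"
    with min show "b' l \<noteq> \<beta>" unfolding kernel_family_def by blast
  qed (use c'1 in auto)
  moreover have "stage_ok (r', b', c', kernel_family r' b' c')"
    using subspace_kernel_family by (auto simp: kernel_family_def)
  ultimately show ?thesis by blast
qed

section \<open>Membership in monomial ideals\<close>

lemma is_ideal_sum:
  assumes "is_ideal I" "finite A" "\<And>a. a \<in> A \<Longrightarrow> f a \<in> I"
  shows "sum f A \<in> I"
  using assms(2,3) by (induction A) (use assms(1) in \<open>auto simp: is_ideal_def\<close>)

lemma sum_single_lookup: "(\<Sum>m\<in>keys f. Poly_Mapping.single m (lookup f m)) = f"
proof (rule poly_mapping_eqI)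
  fix m
  have "lookup (\<Sum>m\<in>keys f. Poly_Mapping.single m (lookup f m)) m =
      (\<Sum>m'\<in>keys f. if m' = m then lookup f m else 0)"
    unfolding lookup_sum by (rule sum.cong) (auto simp: lookup_single)
  also have "\<dots> = lookup f m" by (simp add: sum.delta in_keys_iff)
  finally show "lookup (\<Sum>m\<in>keys f. Poly_Mapping.single m (lookup f m)) m = lookup f m" .
qed

lemma monomial_ideal_iff:
  assumes "monomial_ideal I"
  shows "f \<in> I \<longleftrightarrow> (\<forall>m\<in>keys f. monom m \<in> I)"
proof
  assume R: "\<forall>m\<in>keys f. monom m \<in> I"
  have I: "is_ideal I" using assms by (simp add: monomial_ideal_def)
  have "(\<Sum>m\<in>keys f. Poly_Mapping.single m (lookup f m)) \<in> I"
  proof (rule is_ideal_sum[OF I])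
    fix m
    assume "m \<in> keys f"
    with R I have "Poly_Mapping.single 0 (lookup f m) * monom m \<in> I" by (simp add: is_ideal_def)
    then show "Poly_Mapping.single m (lookup f m) \<in> I" by (simp add: monom_def mult_single)
  qed simp
  then show "f \<in> I" by (simp add: sum_single_lookup)
qed (use assms in \<open>simp add: monomial_ideal_def\<close>)

lemma ideal_monom_mono:
  assumes "is_ideal I" "monom a \<in> I" "mdvd a b"
  shows "monom b \<in> (I :: ('n, 'a::field) mpoly set)"
proof -
  have "monom (b - a) * monom a \<in> I" using assms by (simp add: is_ideal_def)
  then show ?thesis using assms(3) by (simp add: monom_def mult_single mdvd_diff_add)
qed

text \<open>Stages are iterated by dependent choice. The image and kernel criteria for monomial
  matrices then convert the degreewise conditions into exactness over the polynomial ring.\<close>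

lemma ex_minimal_resolution:
  fixes J :: "('n::finite, 'a::field) mpoly set"
  assumes J: "monomial_ideal J"
  shows "\<exists>r a d. minimal_graded_free_res J r a d"
proof -
  have idJ: "is_ideal J" using J by (simp add: monomial_ideal_def)
  \<comment> \<open>The initial stage is the ring itself, free on one generator of degree zero, with
    \<open>N0\<close> the degreewise description of \<open>J\<close>.\<close>
  define N0 where "N0 \<beta> = {y :: nat \<Rightarrow> 'a. \<forall>l. y l \<noteq> 0 \<longrightarrow> l = 0 \<and> monom \<beta> \<in> J}" for \<beta>
  define s0 :: "('n, 'a) stage" where "s0 = (1, \<lambda>_. 0, \<lambda>_ _. 0, N0)"
  have "subspace_family 1 N0"
    unfolding subspace_family_def
  proof (intro conjI allI ballI impI)
    fix \<beta> x y d
    assume "x \<in> N0 \<beta>" "y \<in> N0 \<beta>"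
    then have x: "x l \<noteq> 0 \<Longrightarrow> l = 0 \<and> monom \<beta> \<in> J" and y: "y l \<noteq> 0 \<Longrightarrow> l = 0 \<and> monom \<beta> \<in> J" for l
      by (simp_all add: N0_def)
    have "l = 0 \<and> monom \<beta> \<in> J" if "x l + d * y l \<noteq> 0" for l
      using that x[of l] y[of l] by (cases "x l = 0") auto
    then show "(\<lambda>l. x l + d * y l) \<in> N0 \<beta>" by (simp add: N0_def)
  qed (use ideal_monom_mono[OF idJ] in \<open>auto simp: N0_def\<close>)
  then have ok0: "stage_ok s0" by (auto simp: s0_def N0_def supported_def)
  have "\<exists>s. \<forall>n. (stage_ok (s n) \<and> (n = 0 \<longrightarrow> s n = s0)) \<and> stage_step (s n) (s (Suc n))"
  proof (rule dependent_nat_choice)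
    show "\<exists>s. stage_ok s \<and> ((0::nat) = 0 \<longrightarrow> s = s0)" using ok0 by blast
    show "\<exists>s'. (stage_ok s' \<and> (Suc n = 0 \<longrightarrow> s' = s0)) \<and> stage_step s s'"
      if "stage_ok s \<and> (n = 0 \<longrightarrow> s = s0)" for s n
      using ex_stage_step[of s] that by blast
  qed
  then obtain s where s0: "s 0 = s0" and step: "\<And>n. stage_step (s n) (s (Suc n))"
    and ok: "\<And>n. stage_ok (s n)"
    by auto
  define R where "R n = fst (s n)" for n
  define b where "b n = fst (snd (s n))" for n
  define c where "c n = fst (snd (snd (s n)))" for n
  define N where "N n = snd (snd (snd (s n)))" for n
  have s: "s n = (R n, b n, c n, N n)" for n by (simp add: R_def b_def c_def N_def)
  note step' = step[unfolded s stage_step.simps]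
  have cnz: "l < R (Suc n) \<and> k < R n \<and> mdvd (b n k) (b (Suc n) l)" if "c (Suc n) k l \<noteq> 0" for n k l
    using step' that by blast
  have cover: "y \<in> N n \<beta> \<longleftrightarrow>
      (\<exists>z. supported (R (Suc n)) (b (Suc n)) \<beta> z \<and> (\<forall>k. y k = (\<Sum>l<R (Suc n). c (Suc n) k l * z l)))" for n \<beta> y
    using step' by blast
  have kernel: "N (Suc n) \<beta> = kernel_family (R (Suc n)) (b (Suc n)) (c (Suc n)) \<beta>" for n \<beta>
    using step' by blast
  have strict: "b (Suc n) l \<noteq> \<beta>" if "z \<in> N (Suc n) \<beta>" "z l \<noteq> 0" for n \<beta> z l
    using step' that by blast
  have R0: "R 0 = 1" and b0: "b 0 = (\<lambda>_. 0)" and N0: "N 0 = N0"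
    using s[of 0] s0 by (auto simp: s0_def)
  \<comment> \<open>Index shift: stage 0 is the target of \<open>d 0\<close>, so the module with
    index \<open>i\<close> of the resolution is stage \<open>Suc i\<close>.\<close>
  define r where "r i = R (Suc i)" for i
  define d where "d i = mono_matrix (b i) (b (Suc i)) (c (Suc i))" for i
  define a where "a i l = int (mdeg (b (Suc i) l))" for i l
  have trank: "trank r i = R i" for i
    by (cases i) (simp_all add: trank_def r_def R0)
  have tdeg: "tdeg a i k = int (mdeg (b i k))" for i k
    by (cases i) (simp_all add: tdeg_def a_def b0)
  have fmap: "fmap r d i x =
      (\<lambda>k. if k < R i then \<Sum>l<R (Suc i). mono_matrix (b i) (b (Suc i)) (c (Suc i)) k l * x l else 0)" for i x
    by (simp add: fmap_def trank r_def d_def cong: if_cong)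
  have image: "y \<in> fmap r d i ` fvecs r i \<longleftrightarrow> (\<forall>\<beta>. homog_part (b i) \<beta> y \<in> N i \<beta>)"
    if y: "\<forall>k. R i \<le> k \<longrightarrow> y k = 0" for i y
  proof -
    have "y \<in> fmap r d i ` fvecs r i \<longleftrightarrow> (\<exists>x. (\<forall>l. R (Suc i) \<le> l \<longrightarrow> x l = 0) \<and> y = fmap r d i x)"
      by (auto simp: fvecs_def r_def)
    also have "\<dots> \<longleftrightarrow> (\<forall>\<beta>. \<exists>z. supported (R (Suc i)) (b (Suc i)) \<beta> z \<and>
        (\<forall>k. homog_part (b i) \<beta> y k = (\<Sum>l<R (Suc i). c (Suc i) k l * z l)))"
      unfolding fmap by (rule mono_matrix_image) (use cnz y in auto)
    finally show ?thesis by (simp add: cover)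
  qed
  have ker: "x \<in> fvecs r i \<and> fmap r d i x = (\<lambda>_. 0) \<longleftrightarrow>
      x \<in> fvecs r i \<and> (\<forall>\<beta>. homog_part (b (Suc i)) \<beta> x \<in> N (Suc i) \<beta>)" for i x
  proof (rule conj_cong[OF refl])
    assume "x \<in> fvecs r i"
    then have x: "\<forall>l. R (Suc i) \<le> l \<longrightarrow> x l = 0" by (simp add: fvecs_def r_def)
    have "fmap r d i x = (\<lambda>_. 0) \<longleftrightarrow>
        (\<forall>\<beta> k. (\<Sum>l<R (Suc i). c (Suc i) k l * homog_part (b (Suc i)) \<beta> x l) = 0)"
      unfolding fmap by (rule mono_matrix_kernel) (use cnz in auto)
    with supported_homog_part[OF x]
    show "fmap r d i x = (\<lambda>_. 0) \<longleftrightarrow> (\<forall>\<beta>. homog_part (b (Suc i)) \<beta> x \<in> N (Suc i) \<beta>)"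
      by (simp add: kernel kernel_family_def)
  qed
  have "graded_free_res J r a d"
    unfolding graded_free_res_def
  proof (intro conjI allI)
    fix i k l
    show "homog (a i l - tdeg a i k) (d i k l)"
    proof (cases "c (Suc i) k l = 0")
      case False
      then have "mdvd (b i k) (b (Suc i) l)" using cnz by blast
      then have "mdeg (b (Suc i) l) = mdeg (b i k) + mdeg (b (Suc i) l - b i k)"
        by (metis mdeg_add mdvd_add_diff)
      then show ?thesis by (simp add: homog_def a_def tdeg d_def mono_matrix_def)
    qed (simp add: homog_def d_def mono_matrix_def)
  next
    have "f \<in> {fmap r d 0 x 0 | x. x \<in> fvecs r 0} \<longleftrightarrow> f \<in> J" for f
    proof -
      define y where "y = (\<lambda>k::nat. if k = 0 then f else 0)"
      have "f \<in> {fmap r d 0 x 0 | x. x \<in> fvecs r 0} \<longleftrightarrow> y \<in> fmap r d 0 ` fvecs r 0"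
        by (auto simp: y_def fmap_def trank R0 fun_eq_iff image_iff)
      also have "\<dots> \<longleftrightarrow> (\<forall>\<beta>. homog_part (b 0) \<beta> y \<in> N 0 \<beta>)"
        by (rule image) (simp add: y_def R0)
      also have "\<dots> \<longleftrightarrow> (\<forall>m\<in>keys f. monom m \<in> J)"
        by (auto simp: homog_part_def b0 N0 N0_def y_def in_keys_iff)
      also have "\<dots> \<longleftrightarrow> f \<in> J" by (rule monomial_ideal_iff[OF J, symmetric])
      finally show ?thesis .
    qed
    then show "{fmap r d 0 x 0 | x. x \<in> fvecs r 0} = J" by (rule set_eqI)
  next
    fix i
    have "x \<in> fmap r d (Suc i) ` fvecs r (Suc i) \<longleftrightarrow> x \<in> fvecs r i \<and> fmap r d i x = (\<lambda>_. 0)" for x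
    proof (cases "x \<in> fvecs r i")
      case True
      then have "\<forall>k. R (Suc i) \<le> k \<longrightarrow> x k = 0" by (simp add: fvecs_def r_def)
      from image[OF this] ker[of x i] True show ?thesis by simp
    next
      case False
      then show ?thesis by (auto simp: fvecs_def fmap r_def)
    qed
    then show "{x \<in> fvecs r i. fmap r d i x = (\<lambda>_. 0)} = fmap r d (Suc i) ` fvecs r (Suc i)"
      by (intro set_eqI) simp
  qed
  moreover have "lookup (d (Suc i) k l) 0 = 0" for i k l
  proof (rule ccontr)
    assume "lookup (d (Suc i) k l) 0 \<noteq> 0"
    then have c: "c (Suc (Suc i)) k l \<noteq> 0" and "b (Suc (Suc i)) l - b (Suc i) k = 0"
      by (auto simp: d_def mono_matrix_def lookup_single when_def split: if_splits)
    with cnz[OF c] have eq: "b (Suc i) k = b (Suc (Suc i)) l"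
      by (metis add.right_neutral mdvd_add_diff)
    \<comment> \<open>Column \<open>l\<close> is the image of a basis vector, hence an element of
      the previous kernel. A constant entry would be a scalar coefficient at a basis element of the
      same degree, which \<open>strict\<close> forbids.\<close>
    have "(\<lambda>k. c (Suc (Suc i)) k l) \<in> N (Suc i) (b (Suc (Suc i)) l)"
      unfolding cover
    proof (intro exI[of _ "\<lambda>m. if m = l then 1 else 0"] conjI allI)
      show "supported (R (Suc (Suc i))) (b (Suc (Suc i))) (b (Suc (Suc i)) l) (\<lambda>m. if m = l then 1 else 0)"
        using cnz[OF c] by (auto simp: supported_def)
      show "c (Suc (Suc i)) k l = (\<Sum>m<R (Suc (Suc i)). c (Suc (Suc i)) k m * (if m = l then 1 else 0))" for k
        using cnz[OF c] by (simp add: sum.delta if_distrib cong: if_cong)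
    qed
    from strict[OF this c] eq show False by simp
  qed
  ultimately show ?thesis unfolding minimal_graded_free_res_def by blast
qed

subsection \<open>Linear resolutions\<close>

text \<open>Existence of a minimal resolution makes the choice inside \<open>betti\<close> a genuine
  one. A basis element off the linear strand would then be counted by a Betti number that
  vanishes.\<close>

lemma linear_resolution_shifts:
  fixes J :: "('n::finite, 'a::field) mpoly set"
  assumes J: "monomial_ideal J" and lin: "linear_resolution J"
  obtains r a d D where "graded_free_res J r a d" "\<And>i l. l < r i \<Longrightarrow> a i l = int i + D"
proof -
  define R where "R = (SOME (r, a, d). minimal_graded_free_res J r a d)"
  obtain r a d where R: "R = (r, a, d)" by (cases R)
  have "\<exists>x. case x of (r, a, d) \<Rightarrow> minimal_graded_free_res J r a d"
    using ex_minimal_resolution[OF J] by auto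
  then have "case R of (r, a, d) \<Rightarrow> minimal_graded_free_res J r a d"
    unfolding R_def by (rule someI_ex)
  with R have res: "graded_free_res J r a d" by (simp add: minimal_graded_free_res_def)
  have betti: "betti J i j = card {l. l < r i \<and> a i l = j}" for i j
    using R by (simp add: betti_def R_def)
  obtain D where D: "\<And>i t. t \<noteq> D \<Longrightarrow> betti J i (int i + t) = 0"
    using lin unfolding linear_resolution_def by blast
  have "a i l = int i + D" if "l < r i" for i l
  proof (rule ccontr)
    assume "a i l \<noteq> int i + D"
    then have "betti J i (int i + (a i l - int i)) = 0" by (intro D) simp
    then have "{l'. l' < r i \<and> a i l' = a i l} = {}" by (simp add: betti)
    with that show False by blast
  qed
  with res show thesis by (rule that)
qed

text \<open>If the ideal is generated in degree \<open>j\<close> and its syzygies are generated by linear ones,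
  then \<open>m\<^sub>1\<close> is linked to \<open>m\<^sub>2\<close> by steps \<open>m \<cdot> x\<^sub>z / x\<^sub>z\<^sub>'\<close>.  The coordinate at \<open>m\<^sub>1\<close>
  of the syzygy \<open>m\<^sub>2 \<cdot> [m\<^sub>1] - m\<^sub>1 \<cdot> [m\<^sub>2]\<close> is \<open>m\<^sub>2\<close>, whereas isolation of \<open>m\<^sub>1\<close> forces
  the coordinate at \<open>m\<^sub>1\<close> of a linear syzygy to involve only variables outside \<open>W\<close>.\<close>

lemma isolated_generator_not_linear:
  fixes J :: "('n::finite, 'a::field) mpoly set"
  assumes J: "monomial_ideal J" and lin: "linear_resolution J"
    and deg: "\<And>m. monom m \<in> J \<Longrightarrow> mdeg m1 \<le> mdeg m"
    and m1: "monom m1 \<in> J" and m2: "monom m2 \<in> J" "mdeg m2 = mdeg m1" "m1 \<noteq> m2"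
    and W: "msupp m2 \<subseteq> W"
    and isolated: "\<And>m z z'. z \<in> W \<Longrightarrow> monom m \<in> J \<Longrightarrow> m + var z' = m1 + var z \<Longrightarrow> m = m1"
  shows False
proof -
  obtain r a d D where res: "graded_free_res J r a d"
    and a: "\<And>i l. l < r i \<Longrightarrow> a i l = int i + D"
    using linear_resolution_shifts[OF J lin] by blast
  have hom: "homog (a i l - tdeg a i k) (d i k l)" for i k l
    using res by (simp add: graded_free_res_def)
  have im: "{fmap r d 0 x 0 | x. x \<in> fvecs r 0} = J"
    using res by (simp add: graded_free_res_def)
  have "{x \<in> fvecs r 0. fmap r d 0 x = (\<lambda>_. 0)} = fmap r d (Suc 0) ` fvecs r (Suc 0)"
    using res unfolding graded_free_res_def by blast
  then have exact: "x \<in> fvecs r 0 \<and> fmap r d 0 x = (\<lambda>_. 0) \<longleftrightarrow>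
      x \<in> fmap r d (Suc 0) ` fvecs r (Suc 0)" for x
    by (simp add: set_eq_iff)
  define f where "f l = d 0 0 l" for l
  define \<sigma> where "\<sigma> = d 1"
  have fmap0: "fmap r d 0 x = (\<lambda>k. if k = 0 then \<Sum>l<r 0. f l * x l else 0)" for x
    by (simp add: fmap_def trank_def f_def fun_eq_iff)
  have fmap1: "fmap r d (Suc 0) x = (\<lambda>k. if k < r 0 then \<Sum>t<r 1. \<sigma> k t * x t else 0)" for x
    by (simp add: fmap_def trank_def \<sigma>_def cong: if_cong)
  have in_J: "g \<in> J \<longleftrightarrow> (\<exists>x\<in>fvecs r 0. g = (\<Sum>l<r 0. f l * x l))" for g
    using im by (auto simp: fmap0)
  have unit: "(\<Sum>l<n. g l * (if l = k then 1 else 0)) = g k" if "k < n" for g :: "nat \<Rightarrow> ('n, 'a) mpoly" and n k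
    using that by (simp add: if_distrib sum.delta cong: if_cong)
  have fJ: "f l \<in> J" if "l < r 0" for l
    unfolding in_J
    by (rule bexI[of _ "\<lambda>m. if m = l then 1 else 0"]) (use that in \<open>auto simp: unit fvecs_def\<close>)
  have f_hom: "int (mdeg m) = D" and f_mon: "monom m \<in> J" if "l < r 0" "lookup (f l) m \<noteq> 0" for l m
    using hom[of 0 l 0] a[OF that(1)] that(2) fJ[OF that(1)] J
    by (auto simp: homog_def tdeg_def f_def in_keys_iff monomial_ideal_def)
  obtain x where x: "x \<in> fvecs r 0" "monom m1 = (\<Sum>l<r 0. f l * x l)" using m1 in_J by blast
  obtain y where y: "y \<in> fvecs r 0" "monom m2 = (\<Sum>l<r 0. f l * y l)" using m2(1) in_J by blast
  \<comment> \<open>Some term of some \<open>f l'\<close> divides \<open>m1\<close>, and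
    \<open>deg\<close> gives it the degree of \<open>m1\<close>; as all \<open>f l\<close> are
    homogeneous of degree \<open>D\<close>, this is their common degree.\<close>
  have f_deg: "mdeg m = mdeg m1" if "l < r 0" "lookup (f l) m \<noteq> 0" for l m
  proof -
    have "lookup (\<Sum>l<r 0. f l * x l) m1 \<noteq> 0" unfolding x(2)[symmetric] by (simp add: monom_def)
    then obtain l' where l': "l' < r 0" "lookup (f l' * x l') m1 \<noteq> 0"
      unfolding lookup_sum by (meson lessThan_iff sum.neutral)
    then have "m1 \<in> keys (f l' * x l')" by (simp add: in_keys_iff)
    then obtain p q where pq: "m1 = p + q" "lookup (f l') p \<noteq> 0"
      using keys_mult[of "f l'" "x l'"] by (auto simp: in_keys_iff)
    have "mdeg m1 \<le> mdeg p" using deg f_mon[OF l'(1) pq(2)] by blast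
    with pq(1) have "mdeg p = mdeg m1" by simp
    with f_hom[OF l'(1) pq(2)] f_hom[OF that] show ?thesis by simp
  qed
  \<comment> \<open>Consecutive shifts differ by one, so the entries of \<sigma> are linear
    forms.\<close>
  have lin1: "mdeg m = 1" if "k < r 0" "t < r 1" "lookup (\<sigma> k t) m \<noteq> 0" for k t m
    using hom[of 1 t k] a[OF that(1)] a[OF that(2)] that(3)
    by (simp add: homog_def tdeg_def \<sigma>_def in_keys_iff)
  \<comment> \<open>\<open>c l\<close> is the coefficient of \<open>m1\<close> in the generator
    \<open>f l\<close>, so \<open>\<Lambda>\<close> extracts the coordinate at \<open>m1\<close>
    when a vector over the \<open>f l\<close> is rewritten over the monomials.\<close>
  define c where "c l = lookup (f l) m1" for l
  define \<Lambda> where "\<Lambda> X = (\<Sum>k<r 0. Poly_Mapping.single 0 (c k) * X k)" for X :: "nat \<Rightarrow> ('n, 'a) mpoly"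
  have lookup_\<Lambda>: "lookup (\<Lambda> X) m = (\<Sum>k<r 0. c k * lookup (X k) m)" for X m
    by (simp add: \<Lambda>_def lookup_sum lookup_single_mult)
  \<comment> \<open>The syzygy between \<open>m1\<close> and \<open>m2\<close>, expressed through
    the generators \<open>f l\<close>.\<close>
  define X where "X k = monom m2 * x k - monom m1 * y k" for k
  have "(\<Sum>l<r 0. f l * X l) = monom m2 * (\<Sum>l<r 0. f l * x l) - monom m1 * (\<Sum>l<r 0. f l * y l)"
    by (simp add: X_def sum_subtractf sum_distrib_left algebra_simps)
  also have "\<dots> = 0" unfolding x(2)[symmetric] y(2)[symmetric] by (simp add: mult.commute)
  finally have "fmap r d 0 X = (\<lambda>_. 0)" by (auto simp: fmap0)
  moreover have "X \<in> fvecs r 0" using x(1) y(1) by (simp add: fvecs_def X_def)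
  ultimately obtain w where "X = fmap r d (Suc 0) w" using exact by blast
  then have w: "X k = (\<Sum>t<r 1. \<sigma> k t * w t)" if "k < r 0" for k
    using that by (simp add: fmap1)
  \<comment> \<open>Since \<open>m1\<close> does not divide \<open>m2\<close>, only the constant
    term of \<open>\<Lambda> x\<close> counts. By degrees it equals the coefficient of
    \<open>m1\<close> in the combination of the \<open>f l\<close> that represents
    \<open>m1\<close>.\<close>
  have "lookup (\<Lambda> X) m2 = 1"
  proof -
    have "\<Lambda> X = monom m2 * \<Lambda> x - monom m1 * \<Lambda> y"
      by (simp add: \<Lambda>_def X_def sum_subtractf sum_distrib_left algebra_simps)
    moreover have "\<not> mdvd m1 m2" using m2 mdvd_mdeg_eq[of m1 m2] by auto
    ultimately have "lookup (\<Lambda> X) m2 = lookup (\<Lambda> x) 0"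
      by (simp add: lookup_minus monom_def lookup_single_mult)
    also have "\<dots> = (\<Sum>k<r 0. lookup (f k * x k) m1)"
      unfolding lookup_\<Lambda>
    proof (rule sum.cong[OF refl])
      fix k
      assume k: "k \<in> {..<r 0}"
      have "lookup (f k * x k) (m1 + 0) = lookup (f k) m1 * lookup (x k) 0"
      proof (rule lookup_mult_unique)
        fix p q
        assume pq: "p + q = m1 + 0" "lookup (f k) p \<noteq> 0"
        then have "mdeg p + mdeg q = mdeg m1" by (metis mdeg_add add.right_neutral)
        with pq k f_deg[of k p] have "mdeg q = 0" by simp
        then have "q = 0" by (simp only: mdeg_eq_0_iff)
        with pq show "p = m1" by simp
      qed
      then show "c k * lookup (x k) 0 = lookup (f k * x k) m1" by (simp add: c_def)
    qed
    also have "\<dots> = lookup (monom m1 :: ('n, 'a) mpoly) m1" by (simp add: x(2) lookup_sum)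
    finally show ?thesis by (simp add: monom_def)
  qed
  moreover have "lookup (\<Lambda> X) m2 = 0"
  proof -
    have "\<Lambda> X = (\<Sum>k<r 0. Poly_Mapping.single 0 (c k) * (\<Sum>t<r 1. \<sigma> k t * w t))"
      unfolding \<Lambda>_def by (rule sum.cong) (auto simp: w)
    also have "\<dots> = (\<Sum>k<r 0. \<Sum>t<r 1. Poly_Mapping.single 0 (c k) * \<sigma> k t * w t)"
      by (simp add: sum_distrib_left mult.assoc)
    also have "\<dots> = (\<Sum>t<r 1. \<Sum>k<r 0. Poly_Mapping.single 0 (c k) * \<sigma> k t * w t)"
      by (rule sum.swap)
    also have "\<dots> = (\<Sum>t<r 1. \<Lambda> (\<lambda>k. \<sigma> k t) * w t)"
      by (simp add: \<Lambda>_def sum_distrib_right)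
    finally have eq: "\<Lambda> X = (\<Sum>t<r 1. \<Lambda> (\<lambda>k. \<sigma> k t) * w t)" .
    \<comment> \<open>A contribution would need a variable \<open>z\<close> dividing
      \<open>m2\<close>, hence in \<open>W\<close>. Isolation of \<open>m1\<close> identifies its
      coefficient with that of \<open>m1 + var z\<close> in the relation given by column
      \<open>t\<close>, which is zero.\<close>
    have "lookup (\<Lambda> (\<lambda>k. \<sigma> k t) * w t) m2 = 0" if t: "t < r 1" for t
    proof (rule ccontr)
      assume "lookup (\<Lambda> (\<lambda>k. \<sigma> k t) * w t) m2 \<noteq> 0"
      then have "m2 \<in> keys (\<Lambda> (\<lambda>k. \<sigma> k t) * w t)" by (simp add: in_keys_iff)
      then obtain p q where pq: "m2 = p + q" "lookup (\<Lambda> (\<lambda>k. \<sigma> k t)) p \<noteq> 0"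
        using keys_mult[of "\<Lambda> (\<lambda>k. \<sigma> k t)" "w t"] by (auto simp: in_keys_iff)
      from pq(2) obtain k where k: "k < r 0" "lookup (\<sigma> k t) p \<noteq> 0"
        unfolding lookup_\<Lambda> by (metis (no_types, lifting) lessThan_iff mult_zero_right sum.neutral)
      then have "mdeg p = 1" using lin1 t by blast
      then obtain z where z: "p = var z" using mdeg_eq_1_iff by blast
      then have "z \<in> W" using W pq(1) by (auto simp: msupp_def lookup_add var_def)
      have "lookup (\<Lambda> (\<lambda>k. \<sigma> k t)) (var z) = (\<Sum>k<r 0. lookup (f k * \<sigma> k t) (m1 + var z))"
        unfolding lookup_\<Lambda>
      proof (rule sum.cong[OF refl])
        fix k
        assume k: "k \<in> {..<r 0}"
        have "lookup (f k * \<sigma> k t) (m1 + var z) = lookup (f k) m1 * lookup (\<sigma> k t) (var z)"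
        proof (rule lookup_mult_unique)
          fix p q
          assume pq: "p + q = m1 + var z" "lookup (f k) p \<noteq> 0" "lookup (\<sigma> k t) q \<noteq> 0"
          then obtain z' where "q = var z'" using lin1[of k t q] t k mdeg_eq_1_iff by auto
          with pq k f_mon[of k p] isolated[OF \<open>z \<in> W\<close>, of p z'] show "p = m1" by simp
        qed
        then show "c k * lookup (\<sigma> k t) (var z) = lookup (f k * \<sigma> k t) (m1 + var z)"
          by (simp add: c_def)
      qed
      also have "\<dots> = lookup (\<Sum>k<r 0. f k * \<sigma> k t) (m1 + var z)" by (simp add: lookup_sum)
      also have "(\<Sum>k<r 0. f k * \<sigma> k t) = 0"
      proof -
        define e :: "nat \<Rightarrow> ('n, 'a) mpoly" where "e = (\<lambda>m. if m = t then 1 else 0)"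
        have "e \<in> fvecs r (Suc 0)" using t by (simp add: fvecs_def e_def)
        then have "fmap r d 0 (fmap r d (Suc 0) e) = (\<lambda>_. 0)" using exact by blast
        then have "(\<Sum>k<r 0. f k * fmap r d (Suc 0) e k) = 0"
          unfolding fmap0 by (metis (mono_tags))
        moreover have "fmap r d (Suc 0) e k = \<sigma> k t" if "k < r 0" for k
          using that unit[OF t] by (simp add: fmap1 e_def)
        ultimately show ?thesis by simp
      qed
      finally show False using pq(2) z by simp
    qed
    then show ?thesis by (simp add: eq lookup_sum)
  qed
  ultimately show False by simp
qed

subsection \<open>Monomials in powers and degree components\<close>

lemma is_ideal_ideal_gen: "is_ideal (ideal_gen X)"
  by (auto simp: is_ideal_def ideal_gen_def)

lemma ideal_gen_superset: "X \<subseteq> ideal_gen X"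
  by (auto simp: ideal_gen_def)

lemma ideal_gen_least: "is_ideal J \<Longrightarrow> X \<subseteq> J \<Longrightarrow> ideal_gen X \<subseteq> J"
  by (auto simp: ideal_gen_def)

text \<open>Serves to bound the exponents in a generated ideal: it suffices to check the
  generators.\<close>

lemma is_ideal_keys_subset:
  fixes M :: "('n \<Rightarrow>\<^sub>0 nat) set"
  assumes up: "\<And>m m'. m \<in> M \<Longrightarrow> m' + m \<in> M"
  shows "is_ideal {f :: ('n, 'a::field) mpoly. keys f \<subseteq> M}"
  unfolding is_ideal_def
proof (intro conjI ballI allI)
  fix f g :: "('n, 'a) mpoly"
  assume "f \<in> {f. keys f \<subseteq> M}" "g \<in> {f. keys f \<subseteq> M}"
  then show "f + g \<in> {f. keys f \<subseteq> M}" using Poly_Mapping.keys_add[of f g] by auto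
next
  fix f g :: "('n, 'a) mpoly"
  assume "f \<in> {f. keys f \<subseteq> M}"
  then show "g * f \<in> {f. keys f \<subseteq> M}" using keys_mult[of g f] up by fastforce
qed simp

lemma ideal_gen_monoms_keys:
  assumes "f \<in> ideal_gen {monom m | m. P m}" "m \<in> keys f"
  shows "\<exists>m'. P m' \<and> mdvd m' m"
proof -
  have "is_ideal {f :: ('a, 'b) mpoly. keys f \<subseteq> {m. \<exists>m'. P m' \<and> mdvd m' m}}"
    by (rule is_ideal_keys_subset) (blast intro: mdvd_trans mdvd_add(2))
  then have "ideal_gen {monom m | m. P m} \<subseteq> {f :: ('a, 'b) mpoly. keys f \<subseteq> {m. \<exists>m'. P m' \<and> mdvd m' m}}"
    by (rule ideal_gen_least) (auto simp: monom_def intro: mdvd_refl)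
  with assms show ?thesis by blast
qed

lemma monom_in_deg_compI: "monom m \<in> I \<Longrightarrow> mdeg m = j \<Longrightarrow> monom m \<in> deg_comp I j"
  unfolding deg_comp_def by (rule subsetD[OF ideal_gen_superset]) blast

lemma monomial_ideal_deg_comp: "monomial_ideal (deg_comp I j)"
  unfolding monomial_ideal_def
proof (intro conjI ballI)
  show id: "is_ideal (deg_comp I j)" unfolding deg_comp_def by (rule is_ideal_ideal_gen)
  fix f m
  assume "f \<in> deg_comp I j" "m \<in> keys f"
  then have "\<exists>m'. (monom m' \<in> I \<and> mdeg m' = j) \<and> mdvd m' m"
    unfolding deg_comp_def by (intro ideal_gen_monoms_keys)
  then obtain m' where m': "monom m' \<in> I" "mdeg m' = j" "mdvd m' m" by blast
  then have "monom m' \<in> deg_comp I j" by (intro monom_in_deg_compI)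
  with id show "monom m \<in> deg_comp I j" using m'(3) by (rule ideal_monom_mono)
qed

lemma monom_in_deg_compD:
  assumes "monom m \<in> deg_comp I j"
  shows "\<exists>m'. monom m' \<in> I \<and> mdeg m' = j \<and> mdvd m' m"
  using ideal_gen_monoms_keys[of "monom m" "\<lambda>m. monom m \<in> I \<and> mdeg m = j" m] assms
  by (auto simp: deg_comp_def monom_def)

section \<open>Exponents occurring in powers\<close>

text \<open>An upper bound for the exponents in \<open>ideal_pow I k\<close>, given by
  factorisations so that they can be argued about factor by factor.\<close>

fun pow_exps :: "('n, 'a::field) mpoly set \<Rightarrow> nat \<Rightarrow> ('n \<Rightarrow>\<^sub>0 nat) set" where
  "pow_exps I 0 = UNIV"
| "pow_exps I (Suc k) = {p + q | p q. monom p \<in> I \<and> q \<in> pow_exps I k}"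

lemma pow_exps_up: "m \<in> pow_exps I k \<Longrightarrow> m' + m \<in> pow_exps I k"
proof (induction k arbitrary: m)
  case (Suc k)
  then obtain p q where "m = p + q" "monom p \<in> I" "q \<in> pow_exps I k" by auto
  then have "m' + m = p + (m' + q)" "m' + q \<in> pow_exps I k"
    using Suc.IH[of q] by (simp_all add: algebra_simps)
  with \<open>monom p \<in> I\<close> show ?case unfolding pow_exps.simps by blast
qed simp

lemma keys_ideal_pow:
  assumes I: "monomial_ideal I"
  shows "f \<in> ideal_pow I k \<Longrightarrow> keys f \<subseteq> pow_exps I k"
proof (induction k arbitrary: f)
  case (Suc k)
  have "ideal_pow I (Suc k) \<subseteq> {f. keys f \<subseteq> pow_exps I (Suc k)}"
    unfolding ideal_pow.simps
  proof (rule ideal_gen_least)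
    show "is_ideal {f :: ('a, 'b) mpoly. keys f \<subseteq> pow_exps I (Suc k)}"
      by (rule is_ideal_keys_subset) (rule pow_exps_up)
    show "{a * b | a b. a \<in> I \<and> b \<in> ideal_pow I k} \<subseteq> {f. keys f \<subseteq> pow_exps I (Suc k)}"
    proof clarify
      fix a b m
      assume ab: "a \<in> I" "b \<in> ideal_pow I k" "m \<in> keys (a * b)"
      then obtain p q where "m = p + q" and p: "p \<in> keys a" and q: "q \<in> keys b"
        using keys_mult[of a b] by auto
      moreover have "monom p \<in> I" using I ab(1) p by (simp add: monomial_ideal_def)
      moreover have "q \<in> pow_exps I k" using Suc.IH[OF ab(2)] q by blast
      ultimately show "m \<in> pow_exps I (Suc k)" unfolding pow_exps.simps by blast
    qed
  qed
  with Suc.prems show ?case by blast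
qed simp

lemma is_ideal_ideal_pow: "is_ideal (ideal_pow I k)"
  by (cases k) (simp_all add: is_ideal_ideal_gen, simp add: is_ideal_def)

text \<open>Exponents are written additively, so the constant sum is the exponent vector of a
  \<open>k\<close>-th power.\<close>

lemma monom_sum_in_ideal_pow:
  assumes "monom u \<in> I"
  shows "monom (\<Sum>i<k. u) \<in> ideal_pow I k"
proof (induction k)
  case (Suc k)
  have "monom (\<Sum>i<Suc k. u) = monom u * (monom (\<Sum>i<k. u) :: ('a, 'b) mpoly)"
    by (simp add: monom_def mult_single add.commute)
  also have "\<dots> \<in> ideal_pow I (Suc k)"
    unfolding ideal_pow.simps
    by (rule subsetD[OF ideal_gen_superset]) (use assms Suc.IH in blast)
  finally show ?case .
qed simp

lemma lookup_sum_const: "lookup (\<Sum>i<k. u) j = k * lookup u (j :: 'n)" for u :: "'n \<Rightarrow>\<^sub>0 nat"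
  by (simp add: lookup_sum)

lemma mdeg_sum_const: "mdeg (\<Sum>i<k. u) = k * mdeg (u :: 'n::finite \<Rightarrow>\<^sub>0 nat)"
  by (simp add: mdeg_UNIV lookup_sum_const sum_distrib_left)

lemma ex_mingens_mdvd:
  fixes m :: "'n::finite \<Rightarrow>\<^sub>0 nat"
  assumes "monom m \<in> I"
  shows "\<exists>g\<in>mingens I. mdvd g m"
  using assms
proof (induction "mdeg m" arbitrary: m rule: less_induct)
  case less
  show ?case
  proof (cases "m \<in> mingens I")
    case False
    then obtain m' where m': "monom m' \<in> I" "mdvd m' m" "m' \<noteq> m"
      using less.prems unfolding mingens_def by blast
    then have "mdeg m' < mdeg m" using mdvd_mdeg_eq[of m' m] by (meson not_le)
    from less.hyps[OF this m'(1)] m'(2) show ?thesis by (blast intro: mdvd_trans)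
  qed (auto intro: mdvd_refl)
qed

lemma msupp_mono: "mdvd a b \<Longrightarrow> msupp a \<subseteq> msupp b"
  unfolding mdvd_def msupp_def by (metis (mono_tags, lifting) Collect_mono le_zero_eq)

text \<open>Each of the \<open>k\<close> factors is supported in \<open>W\<close>, hence divisible
  by \<open>u\<close> or \<open>v\<close>; either \<open>u\<close> occurs once or every factor is
  divisible by \<open>v\<close>.\<close>

lemma pow_exps_two_generators:
  fixes I :: "('n::finite, 'a::field) mpoly set"
  assumes only: "\<And>w. w \<in> mingens I \<Longrightarrow> msupp w \<subseteq> W \<Longrightarrow> w = u \<or> w = v"
    and "m \<in> pow_exps I k" "msupp m \<subseteq> W"
  shows "mdvd u m \<or> mdvd (\<Sum>i<k. v) m"
  using assms(2,3)
proof (induction k arbitrary: m)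
  case (Suc k)
  then obtain p q where m: "m = p + q" and p: "monom p \<in> I" and q: "q \<in> pow_exps I k" by auto
  have "msupp p \<subseteq> W" "msupp q \<subseteq> W" using Suc.prems(2) m by (auto simp: msupp_def lookup_add)
  obtain g where g: "g \<in> mingens I" "mdvd g p" using ex_mingens_mdvd[OF p] by blast
  with \<open>msupp p \<subseteq> W\<close> have "g = u \<or> g = v" using msupp_mono[of g p] only[of g] by blast
  moreover have "mdvd u q \<or> mdvd (\<Sum>i<k. v) q" using Suc.IH[OF q \<open>msupp q \<subseteq> W\<close>] .
  ultimately consider "mdvd u p" | "mdvd u q" | "mdvd v p" "mdvd (\<Sum>i<k. v) q" using g(2) by blast
  then show ?case
  proof cases
    case 1
    then show ?thesis unfolding m by (blast intro: mdvd_trans mdvd_add)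
  next
    case 2
    then show ?thesis unfolding m by (blast intro: mdvd_trans mdvd_add)
  next
    case 3
    then have "mdvd (\<Sum>i<Suc k. v) m"
      by (simp add: m mdvd_def lookup_add add.commute[of _ "lookup v _"] add_mono)
    then show ?thesis ..
  qed
qed simp

lemma two_generators_not_linear:
  fixes I :: "('n::finite, 'a::field) mpoly set"
  assumes I: "monomial_ideal I" and u: "u \<in> mingens I" and v: "v \<in> mingens I"
    and cop: "mcoprime u v" and degs: "2 \<le> mdeg u" "mdeg u \<le> mdeg v" and s: "s \<ge> 1"
    and only: "\<And>w. w \<in> mingens I \<Longrightarrow> msupp w \<subseteq> msupp u \<union> msupp v \<Longrightarrow> w = u \<or> w = v"
    and lin: "linear_resolution (deg_comp (ideal_pow I s) (s * mdeg v))"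
  shows False
proof -
  define W where "W = msupp u \<union> msupp v"
  define m1 where "m1 = (\<Sum>i<s. v)"
  have disj: "lookup u i = 0 \<or> lookup v i = 0" for i
    using cop unfolding mcoprime_def by (metis min_def)
  have "u \<noteq> 0" using degs by auto
  then obtain x where x: "lookup u x \<noteq> 0" by (metis poly_mapping_eqI lookup_zero)
  \<comment> \<open>The \<open>s\<close>-th power of \<open>u\<close> is padded with a variable of
    \<open>u\<close> to reach the degree of \<open>m1\<close> without leaving
    \<open>W\<close>.\<close>
  define m2 where "m2 = Poly_Mapping.single x (s * (mdeg v - mdeg u)) + (\<Sum>i<s. u)"
  have mdeg1: "mdeg m1 = s * mdeg v" by (simp add: m1_def mdeg_sum_const)
  have mdeg2: "mdeg m2 = s * mdeg v"
  proof -
    have "mdeg (Poly_Mapping.single x k) = k" for k by (simp add: mdeg_def)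
    then have "mdeg m2 = s * (mdeg v - mdeg u) + s * mdeg u" by (simp add: m2_def mdeg_sum_const)
    then show ?thesis using degs by (simp flip: distrib_left)
  qed
  let ?J = "deg_comp (ideal_pow I s) (s * mdeg v)"
  have uI: "monom u \<in> I" and vI: "monom v \<in> I" using u v by (simp_all add: mingens_def)
  have "monom m1 \<in> ?J"
    using monom_sum_in_ideal_pow[OF vI] mdeg1 by (auto simp: m1_def intro: monom_in_deg_compI)
  moreover have "monom m2 \<in> ?J"
  proof (rule monom_in_deg_compI[OF _ mdeg2])
    show "monom m2 \<in> ideal_pow I s"
      by (rule ideal_monom_mono[OF is_ideal_ideal_pow monom_sum_in_ideal_pow[OF uI]])
        (simp add: m2_def)
  qed
  moreover have "m1 \<noteq> m2"
  proof
    assume "m1 = m2"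
    then have "lookup m1 x = lookup m2 x" by simp
    with disj[of x] x s show False
      by (simp add: m1_def m2_def lookup_add lookup_sum_const)
  qed
  moreover have "msupp m2 \<subseteq> W"
    using x by (auto simp: m2_def W_def msupp_def lookup_add lookup_sum_const lookup_single when_def split: if_splits)
  moreover have "mdeg m1 \<le> mdeg m" if "monom m \<in> ?J" for m
    using monom_in_deg_compD[OF that] mdvd_mdeg_le mdeg1 by metis
  \<comment> \<open>A neighbour \<open>m\<close> of \<open>m1\<close> stays inside \<open>W\<close>
    and so is divisible by \<open>u\<close> or \<open>m1\<close>. If \<open>u\<close> divided it,
    \<open>u\<close> would divide \<open>m1 + var z\<close>, and coprimality to \<open>v\<close>
    would leave \<open>u\<close> dividing a single variable, against its degree.\<close>
  moreover have "m = m1" if z: "z \<in> W" and m: "monom m \<in> ?J" and eq: "m + var z' = m1 + var z" for m z z'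
  proof -
    have var1: "mdeg (var z) = 1" for z :: 'n by (simp add: mdeg_def var_def)
    have degm: "mdeg m = mdeg m1"
    proof -
      have "mdeg (m + var z') = mdeg (m1 + var z)" by (simp only: eq)
      then show ?thesis by (simp only: mdeg_add var1)
    qed
    obtain m' where m': "monom m' \<in> ideal_pow I s" "mdeg m' = s * mdeg v" "mdvd m' m"
      using monom_in_deg_compD[OF m] by blast
    then have "m' = m" using degm mdeg1 by (intro mdvd_mdeg_eq) auto
    with m'(1) have mE: "m \<in> pow_exps I s"
      using keys_ideal_pow[OF I, of "monom m" s] by (simp add: monom_def)
    have "msupp m \<subseteq> msupp (m1 + var z)" unfolding eq[symmetric] by (rule msupp_mono) simp
    also have "\<dots> \<subseteq> W"
      using z by (auto simp: msupp_def lookup_add m1_def lookup_sum_const var_def lookup_single when_def W_def split: if_splits)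
    finally have "msupp m \<subseteq> W" .
    with only mE have "mdvd u m \<or> mdvd m1 m"
      unfolding m1_def W_def by (intro pow_exps_two_generators)
    moreover have "\<not> mdvd u m"
    proof
      assume "mdvd u m"
      then have um: "lookup u i \<le> lookup (m1 + var z) i" for i
        unfolding eq[symmetric] by (auto simp: mdvd_def lookup_add intro: le_trans)
      have "lookup u i \<le> lookup (var z) i" for i
        using um[of i] disj[of i] by (auto simp: lookup_add m1_def lookup_sum_const)
      then have "mdeg u \<le> mdeg (var z)" by (intro mdvd_mdeg_le) (simp add: mdvd_def)
      with degs var1 show False by simp
    qed
    ultimately show "m = m1" using mdvd_mdeg_eq[of m1 m] degm by simp
  qed
  ultimately show False
    using isolated_generator_not_linear[OF monomial_ideal_deg_comp lin, of m1 m2 W] mdeg1 mdeg2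
    by metis
qed

theorem theorem2p1:
  fixes I :: "('n::finite, 'a::field) mpoly set"
  assumes "monomial_ideal I"
    and "\<forall>i. monom (var i) \<notin> I"
    and "\<exists>s\<ge>1. componentwise_linear (ideal_pow I s)"
  shows "\<forall>u\<in>mingens I. \<forall>v\<in>mingens I. mcoprime u v \<longrightarrow>
           (\<exists>w\<in>mingens I. w \<noteq> u \<and> w \<noteq> v \<and> msupp w \<subseteq> msupp u \<union> msupp v)"
proof -
  obtain s where s: "s \<ge> 1" and lin: "\<And>j. linear_resolution (deg_comp (ideal_pow I s) j)"
    using assms(3) unfolding componentwise_linear_def by blast
  have id: "is_ideal I" using assms(1) by (simp add: monomial_ideal_def)
  \<comment> \<open>A generator of degree 0 would put every variable into \<open>I\<close>, and one
    of degree 1 is itself a variable.\<close>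
  have deg2: "2 \<le> mdeg u" if u: "u \<in> mingens I" for u
  proof (rule ccontr)
    assume "\<not> 2 \<le> mdeg u"
    then consider "mdeg u = 0" | "mdeg u = 1" by linarith
    then show False
    proof cases
      case 1
      then have "monom (var i) \<in> I" for i
        using u ideal_monom_mono[OF id, of u "var i"] by (simp add: mingens_def)
      with assms(2) show False by blast
    next
      case 2
      then obtain i where "u = var i" using mdeg_eq_1_iff by blast
      with u assms(2) show False by (simp add: mingens_def)
    qed
  qed
  show ?thesis
  proof (intro ballI impI, rule ccontr)
    fix u v
    assume u: "u \<in> mingens I" and v: "v \<in> mingens I" and cop: "mcoprime u v"
    assume "\<not> (\<exists>w\<in>mingens I. w \<noteq> u \<and> w \<noteq> v \<and> msupp w \<subseteq> msupp u \<union> msupp v)"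
    then have only: "w = u \<or> w = v" if "w \<in> mingens I" "msupp w \<subseteq> msupp u \<union> msupp v" for w
      using that by blast
    have cop': "mcoprime v u" using cop by (simp add: mcoprime_def min.commute)
    show False
    \<comment> \<open>The claim is symmetric in the two generators, so the one of smaller degree can
      take the role of \<open>u\<close>.\<close>
    proof (cases "mdeg u \<le> mdeg v")
      case True
      show False
        by (rule two_generators_not_linear[OF assms(1) u v cop deg2[OF u] True s only lin])
    next
      case False
      show False
        by (rule two_generators_not_linear[OF assms(1) v u cop' deg2[OF v] _ s _ lin])
          (use False only in \<open>auto simp: Un_commute\<close>)
    qed
  qed
qed

end
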